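(* Let $\{X_t\}_{t\in\mathbb Z}$ be an SFIEGARCH$(p,d,q)_s$ process with $d<0.5$. Suppose that $\gamma$ and $\theta$ are not both equal to zero. Let $\gamma_{\ln(\sigma_t^2)}(\cdot)$ be the autocovariance function of the process $\{\ln(\sigma_t^2)\}_{t\in\mathbb Z}$. Then there is a real function $\mathscr G(\cdot)$ such that, for all $r\in\{0,\dots,s-1\}$, $$\gamma_{\ln(\sigma_t^2)}(sh+r)=\gamma_V(sh)\,\mathscr G(sh+r)+o(h^{-\nu}),\qquad h\to\infty,$$ where $\nu$ is any positive number and $\mathscr G(\cdot)$ satisfies $$\lim_{h\to\infty}\sum_{r=0}^{s-1}\mathscr G(sh+r)=\sum_{k\in\mathbb Z}\gamma_A(k).$$
   Context: An SFIEGARCH$(p,d,q)_s$ process is a process $\{X_t\}_{t\in\mathbb Z}$ defined by $X_t=\sigma_tZ_t$ and $\ln(\sigma_t^2)=\omega+\sum_{k=0}^\infty\lambda_{d,k}g(Z_{t-1-k})$ for all $t\in\mathbb Z$, where: $\{Z_t\}_{t\in\mathbb Z}$ is i.i.d. with zero mean and variance one; $g(Z_t)=\theta Z_t+\gamma[|Z_t|-\mathbb E(|Z_t|)]$ with $\theta,\gamma\in\mathbb R$; $\omega,d\in\mathbb R$; $s\ge1$ is an integer; $\alpha(z)=\sum_{i=0}^p(-\alpha_i)z^i$ and $\beta(z)=\sum_{j=0}^q(-\beta_j)z^j$ are real polynomials of orders $p,q$ with $\alpha_0=\beta_0=-1$, without common roots, and $\beta(z)\neq0$ for $|z|\le1$;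 and $\frac{\alpha(z)}{\beta(z)}(1-z^s)^{-d}=\sum_{k=0}^\infty\lambda_{d,k}z^k$, $|z|<1$. $\gamma_A(h)=\sum_{i=0}^\infty f_if_{i+|h|}$, $h\in\mathbb Z$, where $\frac{\alpha(z)}{\beta(z)}=\sum_{k=0}^\infty f_kz^k$. $\gamma_V(sh)=\sigma_g^2\frac{(-1)^h\Gamma(1-2d)}{\Gamma(1-d+h)\Gamma(1-d-h)}$, $h\in\mathbb Z$ (with $1/\Gamma$ equal to $0$ at nonpositive integers), where $\sigma_g^2=\mathrm{Var}(g(Z_0))=\theta^2+\gamma^2-[\gamma\mathbb E(|Z_0|)]^2+2\theta\gamma\mathbb E(Z_0|Z_0|)$. *)

theory Defs
  imports "HOL-Probability.Probability" "HOL-Library.Landau_Symbols"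
begin

text \<open>
  The polynomial with coefficients \<open>- c 0, \<dots>, - c n\<close>. The convention \<open>c 0 = -1\<close>
  makes its constant term equal to 1. The coefficients are real; the polynomial
  is taken over the complex numbers because its complex roots matter.
\<close>

definition lag_poly :: "nat \<Rightarrow> (nat \<Rightarrow> real) \<Rightarrow> complex poly" where
  "lag_poly n c = (\<Sum>i\<le>n. monom (of_real (- c i)) i)"

definition unit_disc_expansion :: "(complex \<Rightarrow> complex) \<Rightarrow> (nat \<Rightarrow> real) \<Rightarrow> bool" where
  "unit_disc_expansion F c \<longleftrightarrow>
     (\<forall>z. norm z < 1 \<longrightarrow> (\<lambda>k. of_real (c k) * z ^ k) sums F z)"

definition covariance :: "'a measure \<Rightarrow> ('a \<Rightarrow> real) \<Rightarrow> ('a \<Rightarrow> real) \<Rightarrow> real" where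
  "covariance M U V =
     (LINT x|M. (U x - (LINT y|M. U y)) * (V x - (LINT y|M. V y)))"

text \<open>
  Autocovariance at lag \<open>h\<close> read off at base time \<open>t\<close>. For a weakly stationary process
  the value does not depend on \<open>t\<close>.
\<close>

definition autocovariance :: "'a measure \<Rightarrow> (int \<Rightarrow> 'a \<Rightarrow> real) \<Rightarrow> int \<Rightarrow> int \<Rightarrow> real" where
  "autocovariance M Y t h = covariance M (Y (t + h)) (Y t)"

text \<open>The random variable \<open>g(Y) = \<theta> Y + \<gamma> (|Y| - E|Y|)\<close>.\<close>

definition innov :: "'a measure \<Rightarrow> real \<Rightarrow> real \<Rightarrow> ('a \<Rightarrow> real) \<Rightarrow> 'a \<Rightarrow> real" where
  "innov M \<theta> \<gamma> Y = (\<lambda>x. \<theta> * Y x + \<gamma> * (\<bar>Y x\<bar> - (LINT y|M. \<bar>Y y\<bar>)))"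

text \<open>
  In \<open>expansion\<close> the principal branch of the power is used; it is holomorphic there, since
  \<open>1 - z ^ s\<close> has positive real part on the open unit disc. The condition \<open>\<sigma> t x \<noteq> 0\<close>
  ensures that \<open>ln ((\<sigma> t x)\<^sup>2)\<close> is a genuine logarithm (HOL sets \<open>ln 0 = 0\<close>). The series for
  \<open>ln ((\<sigma> t)\<^sup>2)\<close> converges almost surely.
\<close>

locale sfiegarch = prob_space M
  for M :: "'a measure" +
  fixes p q s :: nat
    and d \<omega> \<theta> \<gamma> :: real
    and a b :: "nat \<Rightarrow> real"
    and lam :: "nat \<Rightarrow> real"
    and Z \<sigma> X :: "int \<Rightarrow> 'a \<Rightarrow> real"
  assumes s_pos: "s \<ge> 1"
    and a0: "a 0 = - 1"
    and b0: "b 0 = - 1"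
    and order_a: "degree (lag_poly p a) = p"
    and order_b: "degree (lag_poly q b) = q"
    and no_common_roots:
      "\<not> (\<exists>z. poly (lag_poly p a) z = 0 \<and> poly (lag_poly q b) z = 0)"
    and b_nonzero: "\<And>z. norm z \<le> 1 \<Longrightarrow> poly (lag_poly q b) z \<noteq> 0"
    and expansion: "unit_disc_expansion
      (\<lambda>z. poly (lag_poly p a) z / poly (lag_poly q b) z
            * (1 - z ^ s) powr (- complex_of_real d)) lam"
    and Z_indep: "indep_vars (\<lambda>_. borel) Z UNIV"
    and Z_ident: "\<And>t. distr M borel (Z t) = distr M borel (Z 0)"
    and Z_integrable: "\<And>t. integrable M (Z t)"
    and Z_mean: "\<And>t. expectation (Z t) = 0"
    and Z_var: "\<And>t. variance (Z t) = 1"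
    and sigma_rv: "\<And>t. random_variable borel (\<sigma> t)"
    and X_rv: "\<And>t. random_variable borel (X t)"
    and sigma_nz: "\<And>t. AE x in M. \<sigma> t x \<noteq> 0"
    and X_eq: "\<And>t. AE x in M. X t x = \<sigma> t x * Z t x"
    and log_vol: "\<And>t. AE x in M.
      (\<lambda>k. lam k * innov M \<theta> \<gamma> (Z (t - 1 - int k)) x) sums (ln ((\<sigma> t x)\<^sup>2) - \<omega>)"

definition gamma_A :: "(nat \<Rightarrow> real) \<Rightarrow> int \<Rightarrow> real" where
  "gamma_A f h = (\<Sum>i. f i * f (i + nat \<bar>h\<bar>))"

text \<open>
  The lag is \<open>n = s * h\<close>; other lags, where the autocovariance of a purely seasonal process
  vanishes, get the value 0. The reciprocal \<open>rGamma\<close> is 0 at the poles of \<open>Gamma\<close>. The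
  parameter \<open>v\<close> is the variance of \<open>g(Z\<^sub>0)\<close>.
\<close>

definition gamma_V :: "nat \<Rightarrow> real \<Rightarrow> real \<Rightarrow> int \<Rightarrow> real" where
  "gamma_V s d v n =
     (if int s dvd n then
        (let h = n div int s in
           v * ((- 1) powi h * Gamma (1 - 2 * d)
                 * rGamma (1 - d + of_int h) * rGamma (1 - d - of_int h)))
      else 0)"

end

theory Submission
  imports Defs "HOL-Complex_Analysis.Complex_Analysis" "HOL-Real_Asymp.Real_Asymp"
begin

text \<open>
Write \<open>v\<close> for the variance of the innovations, \<open>f\<close> for the coefficients of
\<open>\<alpha>(z) / \<beta>(z)\<close> and \<open>c h\<close> for \<open>\<Sum>j. \<pi> j * \<pi> (j + h)\<close>, where \<open>\<pi>\<close> are the coefficients of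
\<open>(1 - z) powr (- d)\<close>. Gauss's theorem evaluates \<open>c h\<close>, and \<open>gamma_V\<close> at lag \<open>s * h\<close> is \<open>v * c h\<close>.

The logarithmic volatility is a linear process with square-summable coefficients \<open>lam\<close> driven by
white noise. Its defining series converges almost surely by assumption and in mean square by
orthogonality, so its autocovariance at lag \<open>n\<close> is \<open>v * (\<Sum>k. lam k * lam (k + n))\<close>
(\<open>log_volatility_autocovariance\<close>). Since \<open>lam\<close> is the convolution of \<open>f\<close> with \<open>\<pi>\<close> spread out to
the multiples of \<open>s\<close>, this equals \<open>v * (\<Sum>i j. f i * f j * A (n + i - j))\<close>
(\<open>has_sum_autocorr_convolve\<close>), where \<open>A (s * m) = c \<bar>m\<bar>\<close> and \<open>A\<close> vanishes at all other lags.

If \<open>d\<close> is not an integer, \<open>c\<close> has no zeros. Take for \<open>G\<close> the quotient of the autocorrelation of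
\<open>lam\<close> by \<open>c\<close>: the error term is then identically zero, and the content is the limit of the sums of
\<open>G\<close> over a period. Among \<open>s\<close> consecutive lags exactly one is a multiple of \<open>s\<close>, so such a
sum is \<open>\<Sum>i j. f i * f j * c \<bar>h + m i j\<bar> / c h\<close> with \<open>\<bar>m i j\<bar> \<le> \<bar>i\<bar> + \<bar>j\<bar>\<close>. Every ratio tends to 1,
because \<open>c (h + 1) / c h = (h + d) / (h + 1 - d)\<close>. The same fact makes \<open>c\<close> vary more slowly than any
exponential, whereas \<open>f\<close> decays exponentially, as \<open>\<beta>\<close> has no zeros on the closed unit disc. So the
limit may be taken termwise (\<open>period_sum_autocorr_asymptotic\<close>). It is \<open>(\<Sum>i. f i)\<^sup>2\<close>, which is also
the sum of \<open>gamma_A f\<close> over all lags (\<open>has_sum_autocorr_all\<close>).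

If \<open>d\<close> is an integer, then \<open>d \<le> 0\<close> and \<open>\<pi>\<close> has finite support. Then \<open>gamma_V\<close> vanishes at all
large lags, the autocovariance decays exponentially, and a constant \<open>G\<close> will do.
\<close>

section \<open>Gauss's summation theorem for the hypergeometric series at 1\<close>

text \<open>
This is the limit that defines \<open>rGamma\<close> in the form used for all asymptotics below. It stays
meaningful at the poles of \<open>Gamma\<close>, where the limit is 0.
\<close>

lemma pochhammer_over_fact_asymptotic:
  fixes z :: real
  shows "(\<lambda>n. pochhammer z n / fact n * real n powr (1 - z)) \<longlonglongrightarrow> rGamma z"
proof -
  have "(\<lambda>n. rGamma_series z n * (real n / (z + real n))) \<longlonglongrightarrow> rGamma z * 1"
  proof (intro tendsto_mult rGamma_series_LIMSEQ)
    show "(\<lambda>n. real n / (z + real n)) \<longlonglongrightarrow> 1"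
      by real_asymp
  qed
  moreover have "\<forall>\<^sub>F n in sequentially.
      rGamma_series z n * (real n / (z + real n)) = pochhammer z n / fact n * real n powr (1 - z)"
    using eventually_gt_at_top[of "max 0 (nat \<lceil>\<bar>z\<bar>\<rceil>)"]
  proof eventually_elim
    case (elim n)
    then have n: "n > 0" "z + real n > 0"
      by linarith+
    have e: "exp (z * ln (real n)) = real n powr z"
      using n by (simp add: powr_def)
    have "rGamma_series z n * (real n / (z + real n)) = pochhammer z n / fact n * (real n / real n powr z)"
      using n by (simp add: rGamma_series_def e pochhammer_Suc)
    also have "real n / real n powr z = real n powr (1 - z)"
      using n by (simp add: powr_diff)
    finally show ?case .
  qed
  ultimately show ?thesis
    by (simp add: Lim_transform_eventually)
qed

text \<open>
The general term, at argument 1, of the hypergeometric series with upper parameters \<open>a\<close>, \<open>b\<close> and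
lower parameter \<open>c\<close>.
\<close>

definition hypergeom_term :: "real \<Rightarrow> real \<Rightarrow> real \<Rightarrow> nat \<Rightarrow> real" where
  "hypergeom_term a b c k = pochhammer a k * pochhammer b k / (pochhammer c k * fact k)"

lemma hypergeom_term_asymptotic:
  assumes "c > 0"
  shows "(\<lambda>k. hypergeom_term a b c k * real k powr (1 + (c - a - b)))
           \<longlonglongrightarrow> rGamma a * rGamma b * Gamma c"
proof -
  have nz: "rGamma c \<noteq> 0"
    using assms by (auto simp: rGamma_eq_zero_iff dest: nonpos_Ints_nonpos)
  have "(\<lambda>k. (pochhammer a k / fact k * real k powr (1 - a)) *
             (pochhammer b k / fact k * real k powr (1 - b)) /
             (pochhammer c k / fact k * real k powr (1 - c))) \<longlonglongrightarrow> rGamma a * rGamma b / rGamma c"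
    by (intro tendsto_intros pochhammer_over_fact_asymptotic nz)
  moreover have "\<forall>\<^sub>F k in sequentially.
     (pochhammer a k / fact k * real k powr (1 - a)) *
             (pochhammer b k / fact k * real k powr (1 - b)) /
             (pochhammer c k / fact k * real k powr (1 - c))
     = hypergeom_term a b c k * real k powr (1 + (c - a - b))"
    using eventually_gt_at_top[of 0]
  proof eventually_elim
    case (elim k)
    have "real k powr (1 - a) * real k powr (1 - b) = real k powr (1 + (c - a - b)) * real k powr (1 - c)"
      using elim by (simp flip: powr_add) (simp add: algebra_simps)
    moreover have "pochhammer c k > 0" using assms by (simp add: pochhammer_pos)
    ultimately show ?case
      using elim by (simp add: hypergeom_term_def field_simps)
  qed
  ultimately have "(\<lambda>k. hypergeom_term a b c k * real k powr (1 + (c - a - b)))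
           \<longlonglongrightarrow> rGamma a * rGamma b / rGamma c"
    by (rule Lim_transform_eventually)
  then show ?thesis by (simp add: rGamma_inverse_Gamma field_simps)
qed

lemma hypergeom_term_bigo:
  assumes "c > 0"
  shows "hypergeom_term a b c \<in> O(\<lambda>k. real k powr (- 1 - (c - a - b)))"
proof -
  let ?g = "\<lambda>k. hypergeom_term a b c k * real k powr (1 + (c - a - b))"
  have "?g \<in> O(\<lambda>_. 1)"
    using hypergeom_term_asymptotic[OF assms]
    by (intro bigoI_tendsto[where c = "rGamma a * rGamma b * Gamma c"]) auto
  then have "(\<lambda>k. ?g k * real k powr (- 1 - (c - a - b))) \<in> O(\<lambda>k. 1 * real k powr (- 1 - (c - a - b)))"
    by (intro landau_o.big.mult) auto
  moreover have "\<forall>\<^sub>F k in sequentially. ?g k * real k powr (- 1 - (c - a - b)) = hypergeom_term a b c k"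
    using eventually_gt_at_top[of 0] by eventually_elim (simp flip: powr_add add: mult.assoc)
  ultimately show ?thesis
    by (simp add: landau_o.big.in_cong)
qed

lemma summable_hypergeom_term:
  assumes "c > 0" "a + b < c"
  shows "summable (\<lambda>k. \<bar>hypergeom_term a b c k\<bar>)"
proof (rule summable_comparison_test_bigo)
  show "summable (\<lambda>k. norm (real k powr (- 1 - (c - a - b))))"
    using assms by (simp add: summable_real_powr_iff)
  show "(\<lambda>k. \<bar>hypergeom_term a b c k\<bar>) \<in> O(\<lambda>k. real k powr (- 1 - (c - a - b)))"
    using hypergeom_term_bigo[OF assms(1)] by simp
qed

text \<open>
The series at \<open>c\<close> and \<open>c + 1\<close> are contiguous: a combination of their terms, with coefficients
free of \<open>k\<close>, is the difference in \<open>k\<close> of \<open>c * k * hypergeom_term a b c k\<close>.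
\<close>

lemma hypergeom_telescope:
  assumes c: "c > 0"
  shows "(c - a) * (c - b) * hypergeom_term a b (c + 1) k - c * (c - a - b) * hypergeom_term a b c k
       = c * real (Suc k) * hypergeom_term a b c (Suc k) - c * real k * hypergeom_term a b c k"
proof -
  define u where "u = hypergeom_term a b c k"
  have pos: "pochhammer c k > 0" "pochhammer (c + 1) k > 0" "c + real k > 0"
    using c by (auto intro!: pochhammer_pos)
  have "c * pochhammer (c + 1) k = (c + real k) * pochhammer c k"
    by (metis pochhammer_rec pochhammer_rec')
  then have poch: "pochhammer (c + 1) k = (c + real k) * pochhammer c k / c"
    using c by (simp add: field_simps)
  have next_c: "hypergeom_term a b (c + 1) k = u * c / (c + real k)"
    using pos c unfolding u_def hypergeom_term_def poch by simp
  have step: "real (Suc k) * hypergeom_term a b c (Suc k) = u * (a + real k) * (b + real k) / (c + real k)"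
    using pos unfolding u_def hypergeom_term_def
    by (simp add: pochhammer_rec' divide_simps del: of_nat_Suc)
  have "c * real (Suc k) * hypergeom_term a b c (Suc k) = c * (u * (a + real k) * (b + real k) / (c + real k))"
    by (simp only: mult.assoc step)
  then show ?thesis
    unfolding next_c u_def[symmetric] using pos
    by (simp add: field_simps)
qed

text \<open>
Summing the telescoping identity leaves no boundary term, because \<open>k * hypergeom_term a b c k\<close>
is of order \<open>k powr (- (c - a - b))\<close>.
\<close>

lemma hypergeom_raise_c:
  assumes c: "c > 0" "a + b < c"
  shows "c * (c - a - b) * (\<Sum>k. hypergeom_term a b c k)
       = (c - a) * (c - b) * (\<Sum>k. hypergeom_term a b (c + 1) k)"
proof -
  have s: "summable (hypergeom_term a b c)" "summable (hypergeom_term a b (c + 1))"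
    using summable_hypergeom_term[of c a b] summable_hypergeom_term[of "c + 1" a b] c
    by (auto intro: summable_rabs_cancel)
  have "(\<lambda>k. real k * hypergeom_term a b c k) \<in> o(\<lambda>_. 1)"
  proof (rule landau_o.big_small_trans)
    show "(\<lambda>k. real k * hypergeom_term a b c k) \<in> O(\<lambda>k. real k * real k powr (- 1 - (c - a - b)))"
      by (intro landau_o.big.mult hypergeom_term_bigo c) auto
    show "(\<lambda>k. real k * real k powr (- 1 - (c - a - b))) \<in> o(\<lambda>_. 1)"
      using c by real_asymp
  qed
  then have "(\<lambda>k. real k * hypergeom_term a b c k) \<longlonglongrightarrow> 0"
    by (auto dest: smalloD_tendsto)
  then have "(\<lambda>k. c * (real k * hypergeom_term a b c k)) \<longlonglongrightarrow> c * 0"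
    by (intro tendsto_mult_left)
  then have "(\<lambda>k. c * real (Suc k) * hypergeom_term a b c (Suc k) - c * real k * hypergeom_term a b c k)
       sums (0 - c * real 0 * hypergeom_term a b c 0)"
    by (intro telescope_sums) (simp add: mult.assoc)
  then have "(\<lambda>k. (c - a) * (c - b) * hypergeom_term a b (c + 1) k
       - c * (c - a - b) * hypergeom_term a b c k) sums 0"
    using hypergeom_telescope[OF c(1), of a b] by simp
  moreover have "(\<lambda>k. (c - a) * (c - b) * hypergeom_term a b (c + 1) k
       - c * (c - a - b) * hypergeom_term a b c k) sums
     ((c - a) * (c - b) * (\<Sum>k. hypergeom_term a b (c + 1) k) - c * (c - a - b) * (\<Sum>k. hypergeom_term a b c k))"
    by (intro sums_diff sums_mult summable_sums s)
  ultimately show ?thesis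
    using sums_unique2 by fastforce
qed

lemma hypergeom_raise_c_iterated:
  assumes c: "c > 0" "a + b < c"
  shows "pochhammer c n * pochhammer (c - a - b) n * (\<Sum>k. hypergeom_term a b c k)
       = pochhammer (c - a) n * pochhammer (c - b) n * (\<Sum>k. hypergeom_term a b (c + real n) k)"
proof (induction n)
  case (Suc n)
  let ?c = "c + real n"
  let ?F = "\<lambda>c. \<Sum>k. hypergeom_term a b c k"
  have "pochhammer c (Suc n) * pochhammer (c - a - b) (Suc n) * ?F c
     = ?c * (?c - a - b) * (pochhammer c n * pochhammer (c - a - b) n * ?F c)"
    by (simp add: pochhammer_Suc algebra_simps)
  also have "\<dots> = pochhammer (c - a) n * pochhammer (c - b) n * (?c * (?c - a - b) * ?F ?c)"
    unfolding Suc.IH by (simp only: mult_ac)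
  also have "?c * (?c - a - b) * ?F ?c = (?c - a) * (?c - b) * ?F (?c + 1)"
    using c by (intro hypergeom_raise_c) auto
  finally show ?case
    by (simp add: pochhammer_Suc algebra_simps)
qed simp

text \<open>
Every term beyond the leading one tends to 0 as \<open>c\<close> grows, and all are dominated by the terms of the
series at the initial \<open>c\<close>.
\<close>

lemma hypergeom_large_c:
  assumes c: "c > 0" "a + b < c"
  shows "(\<lambda>n. \<Sum>k. hypergeom_term a b (c + real n) k) \<longlonglongrightarrow> 1"
proof -
  define t where "t = (\<lambda>k n. hypergeom_term a b (c + real n) k)"
  have lim: "(\<lambda>n. t k n) \<longlonglongrightarrow> (if k = 0 then 1 else 0)" for k
  proof (cases k)
    case (Suc k')
    have mono: "c + real n \<le> pochhammer (c + real n) k" if "n \<ge> 1" for n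
    proof -
      have "1 \<le> pochhammer (c + real n + 1) k'"
        unfolding pochhammer_prod using c that by (intro prod_ge_1) auto
      then show ?thesis
        using c that by (simp add: Suc pochhammer_rec)
    qed
    have "filterlim (\<lambda>n. c + real n) at_top sequentially"
      by real_asymp
    then have "filterlim (\<lambda>n. pochhammer (c + real n) k) at_top sequentially"
      by (rule filterlim_at_top_mono) (use mono in \<open>auto simp: eventually_at_top_linorder\<close>)
    then have "(\<lambda>n. (pochhammer a k * pochhammer b k / fact k) / pochhammer (c + real n) k) \<longlonglongrightarrow> 0"
      by (rule real_tendsto_divide_at_top[OF tendsto_const])
    then show ?thesis
      using Suc by (simp add: t_def hypergeom_term_def mult.commute)
  qed (simp add: t_def hypergeom_term_def)
  have bound: "\<bar>t k n\<bar> \<le> \<bar>hypergeom_term a b c k\<bar>" for k n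
  proof -
    have "0 < pochhammer c k" "pochhammer c k \<le> pochhammer (c + real n) k"
      using c unfolding pochhammer_prod by (auto intro!: prod_pos prod_mono)
    then show ?thesis
      by (auto simp: t_def hypergeom_term_def abs_mult intro!: divide_left_mono mult_right_mono mult_pos_pos)
  qed
  have "(\<lambda>n. \<Sum>k. t k n) \<longlonglongrightarrow> (\<Sum>k. if k = 0 then 1 else 0)"
    using tannerys_theorem[where a = t and F = sequentially and M = "\<lambda>k. \<bar>hypergeom_term a b c k\<bar>",
        OF lim _ summable_hypergeom_term[OF c]] bound by (auto intro!: always_eventually)
  moreover have "(\<Sum>k. if k = 0 then 1 else 0 :: real) = 1"
    using suminf_finite[of "{0::nat}" "\<lambda>k. if k = 0 then 1 else 0 :: real"] by simp
  ultimately show ?thesis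
    by (simp add: t_def)
qed

text \<open>
Raising \<open>c\<close> repeatedly pushes the series towards its leading term 1, and the accumulated factors
are Pochhammer symbols whose quotient converges to the quotient of Gamma functions.
\<close>

theorem gauss_hypergeometric_sum:
  assumes c: "c > 0" "a + b < c"
  shows "hypergeom_term a b c sums (Gamma c * Gamma (c - a - b) * rGamma (c - a) * rGamma (c - b))"
proof -
  let ?F = "\<lambda>c. \<Sum>k. hypergeom_term a b c k"
  let ?q = "\<lambda>z n. pochhammer z n / fact n * real n powr (1 - z)"
  have nz: "rGamma c \<noteq> 0" "rGamma (c - a - b) \<noteq> 0"
    using c by (auto simp: rGamma_eq_zero_iff dest: nonpos_Ints_nonpos)
  have "(\<lambda>n. ?q (c - a) n * ?q (c - b) n / (?q c n * ?q (c - a - b) n) * ?F (c + real n))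
     \<longlonglongrightarrow> rGamma (c - a) * rGamma (c - b) / (rGamma c * rGamma (c - a - b)) * 1"
    using nz by (intro tendsto_intros pochhammer_over_fact_asymptotic hypergeom_large_c c) auto
  moreover have "\<forall>\<^sub>F n in sequentially.
     ?q (c - a) n * ?q (c - b) n / (?q c n * ?q (c - a - b) n) * ?F (c + real n) = ?F c"
    using eventually_gt_at_top[of 0]
  proof eventually_elim
    case (elim n)
    have pos: "pochhammer c n > 0" "pochhammer (c - a - b) n > 0"
      using c by (auto intro!: pochhammer_pos)
    have "real n powr (1 - (c - a)) * real n powr (1 - (c - b)) = real n powr (1 - c) * real n powr (1 - (c - a - b))"
      by (simp flip: powr_add)
    then have "?q (c - a) n * ?q (c - b) n / (?q c n * ?q (c - a - b) n)
         = pochhammer (c - a) n * pochhammer (c - b) n / (pochhammer c n * pochhammer (c - a - b) n)"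
      using elim pos by (simp add: field_simps)
    moreover have "pochhammer (c - a) n * pochhammer (c - b) n / (pochhammer c n * pochhammer (c - a - b) n)
         * ?F (c + real n) = ?F c"
      using hypergeom_raise_c_iterated[OF c, of n] pos by (simp add: field_simps)
    ultimately show ?case
      by (simp only:)
  qed
  ultimately have "(\<lambda>n. ?F c) \<longlonglongrightarrow> rGamma (c - a) * rGamma (c - b) / (rGamma c * rGamma (c - a - b)) * 1"
    by (rule Lim_transform_eventually)
  then have "?F c = rGamma (c - a) * rGamma (c - b) / (rGamma c * rGamma (c - a - b))"
    by (simp add: LIMSEQ_const_iff)
  moreover have "summable (hypergeom_term a b c)"
    using summable_hypergeom_term[OF c] by (rule summable_rabs_cancel)
  ultimately show ?thesis
    by (auto simp: sums_iff rGamma_inverse_Gamma field_simps)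
qed

section \<open>Square-summable sequences and their autocorrelation\<close>

text \<open>
Sequences are extended by zero to all integers, so that shifts and convolutions are bijective
reindexings without boundary cases.
\<close>

definition causal :: "(nat \<Rightarrow> real) \<Rightarrow> int \<Rightarrow> real" where
  "causal c k = (if k < 0 then 0 else c (nat k))"

definition autocorr :: "(int \<Rightarrow> real) \<Rightarrow> int \<Rightarrow> real" where
  "autocorr u m = (\<Sum>\<^sub>\<infinity>k. u k * u (k + m))"

abbreviation square_summable :: "(int \<Rightarrow> real) \<Rightarrow> bool" where
  "square_summable u \<equiv> (\<lambda>k. (u k)\<^sup>2) summable_on UNIV"

lemma bij_add_int: "bij (\<lambda>k. k + (m::int))"
  by (rule bij_betw_byWitness[where f' = "\<lambda>k. k - m"]) auto

lemma abs_mult_le_squares: "\<bar>x * y\<bar> \<le> (x\<^sup>2 + y\<^sup>2) / (2::real)"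
  using zero_le_power2[of "\<bar>x\<bar> - \<bar>y\<bar>"] by (simp add: power2_diff abs_mult)

lemma summable_on_rabs_cancel:
  fixes f :: "'b \<Rightarrow> real"
  shows "(\<lambda>x. \<bar>f x\<bar>) summable_on A \<Longrightarrow> f summable_on A"
  using abs_summable_summable[of f A] by simp

lemma
  assumes u: "square_summable u"
  shows summable_lagged_product: "(\<lambda>k. \<bar>u (k + a) * u (k + b)\<bar>) summable_on UNIV"
    and infsum_lagged_product_le: "(\<Sum>\<^sub>\<infinity>k. \<bar>u (k + a) * u (k + b)\<bar>) \<le> (\<Sum>\<^sub>\<infinity>k. (u k)\<^sup>2)"
proof -
  let ?B = "\<Sum>\<^sub>\<infinity>k. (u k)\<^sup>2"
  have shift: "((\<lambda>k. (u (k + m))\<^sup>2) has_sum ?B) UNIV" for m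
    using has_sum_reindex_bij_betw[OF bij_add_int, of "\<lambda>k. (u k)\<^sup>2" m ?B] u by simp
  have dom: "((\<lambda>k. ((u (k + a))\<^sup>2 + (u (k + b))\<^sup>2) * (1 / 2)) has_sum (?B + ?B) * (1 / 2)) UNIV"
    by (intro has_sum_cmult_left has_sum_add shift)
  show s: "(\<lambda>k. \<bar>u (k + a) * u (k + b)\<bar>) summable_on UNIV"
    by (rule summable_on_comparison_test[OF has_sum_imp_summable[OF dom]])
      (use abs_mult_le_squares in auto)
  show "(\<Sum>\<^sub>\<infinity>k. \<bar>u (k + a) * u (k + b)\<bar>) \<le> ?B"
    using has_sum_mono[OF has_sum_infsum[OF s] dom] abs_mult_le_squares by auto
qed

lemma has_sum_autocorr:
  assumes u: "square_summable u"
  shows "((\<lambda>k. u (k + a) * u (k + b)) has_sum autocorr u (b - a)) UNIV"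
proof -
  have "(\<lambda>k. u k * u (k + (b - a))) summable_on UNIV"
    using summable_lagged_product[OF u, of 0 "b - a"] by (simp add: summable_on_rabs_cancel)
  then have "((\<lambda>k. u k * u (k + (b - a))) has_sum autocorr u (b - a)) UNIV"
    unfolding autocorr_def by simp
  then show ?thesis
    using has_sum_reindex_bij_betw[OF bij_add_int, of "\<lambda>k. u k * u (k + (b - a))" a] by (simp add: algebra_simps)
qed

lemma autocorr_bounded:
  assumes "square_summable u"
  shows "\<bar>autocorr u m\<bar> \<le> (\<Sum>\<^sub>\<infinity>k. (u k)\<^sup>2)"
proof -
  have "\<bar>autocorr u m\<bar> \<le> (\<Sum>\<^sub>\<infinity>k. \<bar>u k * u (k + m)\<bar>)"
    using norm_infsum_bound[of "\<lambda>k. u k * u (k + m)" UNIV] summable_lagged_product[OF assms, of 0 m]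
    by (simp add: autocorr_def)
  then show ?thesis
    using infsum_lagged_product_le[OF assms, of 0 m] by simp
qed

lemma autocorr_minus: 
  assumes "square_summable u"
  shows "autocorr u (- m) = autocorr u m"
proof -
  have 1: "((\<lambda>k. u (k + m) * u k) has_sum autocorr u (- m)) UNIV"
    using has_sum_autocorr[OF assms, of m 0] by simp
  have 2: "((\<lambda>k. u (k + m) * u k) has_sum autocorr u m) UNIV"
    using has_sum_autocorr[OF assms, of 0 m] by (simp add: mult.commute)
  show ?thesis
    by (rule has_sum_unique[OF 1 2])
qed

definition convolve :: "(int \<Rightarrow> real) \<Rightarrow> (int \<Rightarrow> real) \<Rightarrow> int \<Rightarrow> real" where
  "convolve w u k = (\<Sum>\<^sub>\<infinity>i. w i * u (k - i))"

lemma has_sum_convolve: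
  assumes w: "(\<lambda>i. \<bar>w i\<bar>) summable_on UNIV" and u: "square_summable u"
  shows "((\<lambda>i. w i * u (k - i)) has_sum convolve w u k) UNIV"
proof -
  have bound: "\<bar>u j\<bar> \<le> 1 + (\<Sum>\<^sub>\<infinity>k. (u k)\<^sup>2)" for j
  proof -
    have "(\<Sum>k\<in>{j}. (u k)\<^sup>2) \<le> (\<Sum>\<^sub>\<infinity>k. (u k)\<^sup>2)"
      by (intro finite_sum_le_infsum u) auto
    then have "(u j)\<^sup>2 \<le> (\<Sum>\<^sub>\<infinity>k. (u k)\<^sup>2)"
      by (simp only: sum.insert[OF finite.emptyI] empty_iff not_False_eq_True sum.empty add_0_right)
    moreover have "\<bar>u j\<bar> \<le> ((u j)\<^sup>2 + 1) / 2"
      using abs_mult_le_squares[of "u j" 1] by simp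
    ultimately show ?thesis
      using zero_le_power2[of "u j"] by argo
  qed
  have "(\<lambda>i. \<bar>w i\<bar> * (1 + (\<Sum>\<^sub>\<infinity>k. (u k)\<^sup>2))) summable_on UNIV"
    by (intro summable_on_cmult_left w)
  then have "(\<lambda>i. \<bar>w i * u (k - i)\<bar>) summable_on UNIV"
    by (rule summable_on_comparison_test) (auto simp: abs_mult bound mult_left_mono)
  then show ?thesis
    unfolding convolve_def by (rule has_sum_infsum[OF summable_on_rabs_cancel])
qed

text \<open>
Absolute convergence is automatic: for real unconditional sums it is equivalent to convergence.
\<close>

lemma has_sum_mult_real:
  fixes f g :: "_ \<Rightarrow> real"
  assumes "(f has_sum F) A" "(g has_sum G) B"
  shows "((\<lambda>(x, y). f x * g y) has_sum F * G) (A \<times> B)"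
proof -
  have f: "(\<lambda>x. \<bar>f x\<bar>) summable_on A" and g: "(\<lambda>x. \<bar>g x\<bar>) summable_on B"
    using assms[THEN has_sum_imp_summable, THEN summable_on_iff_abs_summable_on_real[THEN iffD1]] by simp_all
  have "(\<lambda>(x, y). \<bar>f x\<bar> * \<bar>g y\<bar>) summable_on A \<times> B"
  proof (rule summable_on_SigmaI)
    show "((\<lambda>y. case (x, y) of (x, y) \<Rightarrow> \<bar>f x\<bar> * \<bar>g y\<bar>) has_sum \<bar>f x\<bar> * (\<Sum>\<^sub>\<infinity>y\<in>B. \<bar>g y\<bar>)) B" for x
      using has_sum_cmult_right[OF has_sum_infsum[OF g]] by simp
    show "(\<lambda>x. \<bar>f x\<bar> * (\<Sum>\<^sub>\<infinity>y\<in>B. \<bar>g y\<bar>)) summable_on A"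
      by (intro summable_on_cmult_left f)
  qed auto
  then have "(\<lambda>p. \<bar>case p of (x, y) \<Rightarrow> f x * g y\<bar>) summable_on A \<times> B"
    by (simp add: case_prod_unfold abs_mult)
  then have s: "(\<lambda>(x, y). f x * g y) summable_on A \<times> B"
    by (rule summable_on_rabs_cancel)
  show ?thesis
    by (rule has_sum_SigmaI[where g = "\<lambda>x. f x * G"])
      (use s assms in \<open>auto intro: has_sum_cmult_right has_sum_cmult_left\<close>)
qed

text \<open>
Fubini for the triple family \<open>w i * w j * u (k - i) * u (k + n - j)\<close>: for fixed \<open>i\<close> and \<open>j\<close>, its
absolute values have a sum over \<open>k\<close> of at most \<open>\<bar>w i\<bar> * \<bar>w j\<bar>\<close> times the sum of the squares of \<open>u\<close>.
\<close>

lemma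
  assumes w: "(\<lambda>i. \<bar>w i\<bar>) summable_on UNIV" and u: "square_summable u"
  shows has_sum_autocorr_convolve: "((\<lambda>k. convolve w u k * convolve w u (k + n)) has_sum
           (\<Sum>\<^sub>\<infinity>(i, j). w i * w j * autocorr u (n + i - j))) UNIV"
    and summable_autocorr_convolve:
      "(\<lambda>(i, j). w i * w j * autocorr u (n + i - j)) summable_on UNIV"
proof -
  let ?B = "\<Sum>\<^sub>\<infinity>k. (u k)\<^sup>2"
  define T where "T = (\<lambda>((i, j), k). w i * w j * (u (k - i) * u (k + n - j)))"
  define R where "R = (\<lambda>(i, j). w i * w j * autocorr u (n + i - j))"
  have ww: "(\<lambda>(i, j). \<bar>w i\<bar> * \<bar>w j\<bar>) summable_on UNIV"
    using has_sum_mult_real[OF has_sum_infsum[OF w] has_sum_infsum[OF w]]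
    by (auto intro: has_sum_imp_summable)
  have inner_abs: "(\<lambda>k. \<bar>T (p, k)\<bar>) summable_on UNIV" for p
    using summable_lagged_product[OF u, of "- fst p" "n - snd p"]
    by (cases p) (auto simp: T_def abs_mult algebra_simps intro!: summable_on_cmult_right)
  have inner_le: "(\<Sum>\<^sub>\<infinity>k. \<bar>T (p, k)\<bar>) \<le> (case p of (i, j) \<Rightarrow> \<bar>w i\<bar> * \<bar>w j\<bar> * ?B)" for p
  proof -
    obtain i j where p: "p = (i, j)" by force
    have "(\<Sum>\<^sub>\<infinity>k. \<bar>T (p, k)\<bar>) = \<bar>w i\<bar> * \<bar>w j\<bar> * (\<Sum>\<^sub>\<infinity>k. \<bar>u (k - i) * u (k + n - j)\<bar>)"
      by (simp add: p T_def abs_mult mult.assoc flip: infsum_cmult_right')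
    also have "\<dots> \<le> \<bar>w i\<bar> * \<bar>w j\<bar> * ?B"
      using infsum_lagged_product_le[OF u, of "- i" "n - j"] 
      by (intro mult_left_mono) (auto simp: algebra_simps)
    finally show ?thesis by (simp add: p)
  qed
  have "(\<lambda>x. \<bar>T x\<bar>) summable_on UNIV \<times> UNIV"
  proof (rule summable_on_SigmaI)
    show "((\<lambda>k. \<bar>T (p, k)\<bar>) has_sum (\<Sum>\<^sub>\<infinity>k. \<bar>T (p, k)\<bar>)) UNIV" for p
      using inner_abs by simp
    have "(\<lambda>p. case p of (i, j) \<Rightarrow> \<bar>w i\<bar> * \<bar>w j\<bar> * ?B) summable_on UNIV"
      using summable_on_cmult_left[OF ww, of ?B] by (simp add: case_prod_unfold)
    then show "(\<lambda>p. \<Sum>\<^sub>\<infinity>k. \<bar>T (p, k)\<bar>) summable_on UNIV"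
    proof (rule summable_on_comparison_test)
      show "(\<Sum>\<^sub>\<infinity>k. \<bar>T (p, k)\<bar>) \<le> (case p of (i, j) \<Rightarrow> \<bar>w i\<bar> * \<bar>w j\<bar> * ?B)" for p
        by (rule inner_le)
    qed (auto intro: infsum_nonneg)
  qed auto
  then have T: "T summable_on UNIV \<times> UNIV"
    by (rule summable_on_rabs_cancel)
  have inner: "((\<lambda>k. T (p, k)) has_sum R p) UNIV" for p
  proof -
    obtain i j where p: "p = (i, j)" by force
    show ?thesis
      using has_sum_cmult_right[OF has_sum_autocorr[OF u, of "- i" "n - j"], of "w i * w j"]
      by (simp add: p T_def R_def algebra_simps)
  qed
  have T_sum: "(T has_sum infsum R UNIV) (UNIV \<times> UNIV)"
    and R: "R summable_on UNIV"
  proof -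
    have "((\<lambda>p. R p) has_sum infsum T (UNIV \<times> UNIV)) UNIV"
      by (rule has_sum_SigmaD[OF has_sum_infsum[OF T]]) (use inner in auto)
    then show "R summable_on UNIV" "(T has_sum infsum R UNIV) (UNIV \<times> UNIV)"
      using T by (auto simp: infsumI dest: has_sum_imp_summable)
  qed
  have "((\<lambda>(k, p). T (p, k)) has_sum infsum R UNIV) (UNIV \<times> UNIV)"
    using T_sum by (subst has_sum_swap) (simp add: case_prod_unfold)
  moreover have "((\<lambda>p. (\<lambda>(k, p). T (p, k)) (k, p)) has_sum convolve w u k * convolve w u (k + n)) UNIV" for k
    using has_sum_mult_real[OF has_sum_convolve[OF w u, of k] has_sum_convolve[OF w u, of "k + n"]]
    by (simp add: T_def case_prod_unfold mult_ac)
  ultimately show "((\<lambda>k. convolve w u k * convolve w u (k + n)) has_sum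
           (\<Sum>\<^sub>\<infinity>(i, j). w i * w j * autocorr u (n + i - j))) UNIV"
    using has_sum_SigmaD[where A = UNIV and B = "\<lambda>_. UNIV" and f = "\<lambda>(k, p). T (p, k)"]
    by (simp add: R_def)
  show "(\<lambda>(i, j). w i * w j * autocorr u (n + i - j)) summable_on UNIV"
    using R by (simp add: R_def)
qed

lemma abs_summable_imp_square_summable:
  assumes w: "(\<lambda>i. \<bar>w i\<bar>) summable_on UNIV"
  shows "square_summable w"
proof -
  have bound: "\<bar>w j\<bar> \<le> (\<Sum>\<^sub>\<infinity>k. \<bar>w k\<bar>)" for j
  proof -
    have "(\<Sum>k\<in>{j}. \<bar>w k\<bar>) \<le> (\<Sum>\<^sub>\<infinity>k. \<bar>w k\<bar>)"
      by (intro finite_sum_le_infsum w) auto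
    then show ?thesis
      by (simp only: sum.insert[OF finite.emptyI] empty_iff not_False_eq_True sum.empty add_0_right)
  qed
  show ?thesis
  proof (rule summable_on_comparison_test)
    show "(\<lambda>i. \<bar>w i\<bar> * (\<Sum>\<^sub>\<infinity>k. \<bar>w k\<bar>)) summable_on UNIV"
      by (intro summable_on_cmult_left w)
    show "(w i)\<^sup>2 \<le> \<bar>w i\<bar> * (\<Sum>\<^sub>\<infinity>k. \<bar>w k\<bar>)" for i
      using mult_left_mono[OF bound[of i] abs_ge_zero[of "w i"]] by (simp add: power2_eq_square flip: abs_mult)
  qed auto
qed

text \<open>
The pairs \<open>(x, y)\<close> are regrouped by their difference \<open>y - x\<close>.
\<close>

lemma has_sum_autocorr_all:
  assumes w: "(\<lambda>i. \<bar>w i\<bar>) summable_on UNIV"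
  shows "(autocorr w has_sum (infsum w UNIV)\<^sup>2) UNIV"
proof -
  have w': "(w has_sum infsum w UNIV) UNIV"
    using w by (rule has_sum_infsum[OF summable_on_rabs_cancel])
  have sq: "square_summable w"
    by (rule abs_summable_imp_square_summable[OF w])
  have "((\<lambda>(x, y). w x * w y) has_sum (infsum w UNIV)\<^sup>2) (UNIV \<times> UNIV)"
    using has_sum_mult_real[OF w' w'] by (simp add: power2_eq_square)
  then have "((\<lambda>(m, k). w k * w (k + m)) has_sum (infsum w UNIV)\<^sup>2) (UNIV \<times> UNIV)"
    by (subst has_sum_reindex_bij_witness[where i = "\<lambda>(x, y). (y - x, x)" and j = "\<lambda>(m, k). (k, k + m)"
         and T = "UNIV \<times> UNIV" and h = "\<lambda>(x, y). w x * w y"]) auto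
  moreover have "((\<lambda>k. (\<lambda>(m, k). w k * w (k + m)) (m, k)) has_sum autocorr w m) UNIV" for m
    using has_sum_autocorr[OF sq, of 0 m] by simp
  ultimately show ?thesis
    by (rule has_sum_SigmaD)
qed

lemma causal_reindex:
  assumes "\<And>k. k < 0 \<Longrightarrow> F k = 0"
  shows "(F has_sum S) UNIV \<longleftrightarrow> ((\<lambda>k. F (int k)) has_sum S) UNIV"
proof -
  have "(F has_sum S) UNIV \<longleftrightarrow> (F has_sum S) (range int)"
  proof (rule has_sum_cong_neutral)
    fix x :: int assume "x \<in> UNIV - range int"
    then have "x < 0" by (metis DiffE nonneg_int_cases not_le rangeI)
    then show "F x = 0" by (rule assms)
  qed auto
  also have "\<dots> \<longleftrightarrow> ((\<lambda>k. F (int k)) has_sum S) UNIV"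
    by (subst has_sum_reindex) (auto simp: o_def)
  finally show ?thesis .
qed

lemma sums_autocorr_causal:
  assumes "square_summable (causal c)"
  shows "(\<lambda>k. c k * c (k + n)) sums autocorr (causal c) (int n)"
proof -
  have "((\<lambda>k. causal c (int k) * causal c (int k + int n)) has_sum autocorr (causal c) (int n)) UNIV"
    using has_sum_autocorr[OF assms, of 0 "int n"]
    by (subst (asm) causal_reindex) (auto simp: causal_def)
  then show ?thesis
    by (auto simp: causal_def nat_int_add dest: has_sum_imp_sums)
qed

lemma summable_causal_square:
  assumes "summable (\<lambda>k. (c k)\<^sup>2)"
  shows "square_summable (causal c)"
proof -
  have "(\<lambda>k. (c k)\<^sup>2) summable_on UNIV"
    using assms by (simp add: summable_on_UNIV_nonneg_real_iff)
  then obtain S where "((\<lambda>k. (causal c (int k))\<^sup>2) has_sum S) UNIV"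
    by (auto simp: causal_def summable_on_def)
  then have "((\<lambda>k. (causal c k)\<^sup>2) has_sum S) UNIV"
    by (subst causal_reindex) (auto simp: causal_def)
  then show ?thesis by (rule has_sum_imp_summable)
qed

lemma gamma_A_eq_autocorr:
  assumes "square_summable (causal f)"
  shows "gamma_A f h = autocorr (causal f) h"
proof -
  have "gamma_A f h = autocorr (causal f) \<bar>h\<bar>"
    using sums_autocorr_causal[OF assms, of "nat \<bar>h\<bar>"] by (auto simp: gamma_A_def sums_iff)
  then show ?thesis
    using autocorr_minus[OF assms, of h] by (auto simp: abs_if)
qed

section \<open>Power series expansions\<close>

lemma power_series_coeffs_unique:
  fixes c c' :: "nat \<Rightarrow> complex"
  assumes "\<And>z. norm z < 1 \<Longrightarrow> (\<lambda>k. c k * z ^ k) sums F z"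
    and "\<And>z. norm z < 1 \<Longrightarrow> (\<lambda>k. c' k * z ^ k) sums F z"
  shows "c = c'"
proof -
  have rad: "fps_conv_radius (Abs_fps a) > 0"
    if "\<And>z. norm z < 1 \<Longrightarrow> (\<lambda>k. a k * z ^ k) sums F z" for a :: "nat \<Rightarrow> complex"
  proof -
    have "summable (\<lambda>k. fps_nth (Abs_fps a) k * (1 / 2) ^ k)"
      using sums_summable[OF that[of "1 / 2"]] by simp
    then have "ereal (norm (1 / 2 :: complex)) \<le> fps_conv_radius (Abs_fps a)"
      unfolding fps_conv_radius_def by (rule conv_radius_geI)
    then show ?thesis
      by (rule less_le_trans[rotated]) simp
  qed
  have "Abs_fps c = Abs_fps c'"
  proof (rule eval_fps_eqD)
    have "eval_fps (Abs_fps c) z = eval_fps (Abs_fps c') z" if "z \<in> ball 0 1" for z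
      using that assms[THEN sums_unique, of z] by (simp add: eval_fps_def dist_norm)
    then show "\<forall>\<^sub>F z in nhds 0. eval_fps (Abs_fps c) z = eval_fps (Abs_fps c') z"
      using eventually_nhds_in_open[of "ball 0 1" "0 :: complex"] by (auto elim: eventually_mono)
  qed (use assms in \<open>auto intro: rad\<close>)
  then show ?thesis
    by (simp add: fps_eq_iff fun_eq_iff)
qed

lemma unit_disc_expansion_unique:
  assumes "unit_disc_expansion F c" "unit_disc_expansion F c'"
  shows "c = c'"
proof -
  have "(\<lambda>k. complex_of_real (c k)) = (\<lambda>k. complex_of_real (c' k))"
    using assms unfolding unit_disc_expansion_def by (intro power_series_coeffs_unique) auto
  then show ?thesis
    by (simp add: fun_eq_iff)
qed

lemma unit_disc_expansion_mult:
  assumes F: "unit_disc_expansion F c" and G: "unit_disc_expansion G c'"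
  shows "unit_disc_expansion (\<lambda>z. F z * G z) (\<lambda>k. \<Sum>i\<le>k. c i * c' (k - i))"
  unfolding unit_disc_expansion_def
proof (intro allI impI)
  fix z :: complex assume z: "norm z < 1"
  have abs: "summable (\<lambda>k. norm (of_real (e k) * z ^ k))" if "unit_disc_expansion E e" for E e
  proof -
    define r where "r = (1 + norm z) / 2"
    have r: "norm (complex_of_real r) = r" "norm z < r" "r < 1"
      using z norm_ge_zero[of z] unfolding norm_of_real r_def by (simp_all add: abs_of_nonneg)
    have "(\<lambda>k. of_real (e k) * complex_of_real r ^ k) sums E (of_real r)"
      using that[unfolded unit_disc_expansion_def, rule_format, of "of_real r"] r by simp
    then have "summable (\<lambda>k. of_real (e k) * complex_of_real r ^ k)"
      by (rule sums_summable)
    moreover have "norm z < norm (complex_of_real r)"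
      using r by simp
    ultimately show ?thesis
      by (rule powser_insidea)
  qed
  have "(\<lambda>k. \<Sum>i\<le>k. (of_real (c i) * z ^ i) * (of_real (c' (k - i)) * z ^ (k - i)))
      sums ((\<Sum>k. of_real (c k) * z ^ k) * (\<Sum>k. of_real (c' k) * z ^ k))"
    by (intro Cauchy_product_sums abs[OF F] abs[OF G])
  also have "(\<lambda>k. \<Sum>i\<le>k. (of_real (c i) * z ^ i) * (of_real (c' (k - i)) * z ^ (k - i)))
      = (\<lambda>k. of_real (\<Sum>i\<le>k. c i * c' (k - i)) * z ^ k)"
  proof
    fix k
    have "(of_real (c i) * z ^ i) * (of_real (c' (k - i)) * z ^ (k - i))
        = of_real (c i * c' (k - i)) * z ^ k" if "i \<le> k" for i
    proof -
      have "z ^ k = z ^ i * z ^ (k - i)"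
        using that by (simp flip: power_add)
      then show ?thesis by simp
    qed
    then show "(\<Sum>i\<le>k. (of_real (c i) * z ^ i) * (of_real (c' (k - i)) * z ^ (k - i)))
      = of_real (\<Sum>i\<le>k. c i * c' (k - i)) * z ^ k"
      unfolding of_real_sum sum_distrib_right by (intro sum.cong) simp_all
  qed
  finally show "(\<lambda>k. of_real (\<Sum>i\<le>k. c i * c' (k - i)) * z ^ k) sums (F z * G z)"
    using F[unfolded unit_disc_expansion_def, rule_format, OF z, THEN sums_unique]
      G[unfolded unit_disc_expansion_def, rule_format, OF z, THEN sums_unique] by simp
qed

text \<open>
The denominator has finitely many zeros, so the quotient is holomorphic on a disc of radius
larger than 1 and its power series converges absolutely there.
\<close>

lemma rational_expansion_decay:
  fixes P Q :: "complex poly"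
  assumes f: "unit_disc_expansion (\<lambda>z. poly P z / poly Q z) f"
    and Q: "\<And>z. norm z \<le> 1 \<Longrightarrow> poly Q z \<noteq> 0"
  obtains y where "y > 1" "summable (\<lambda>k. \<bar>f k\<bar> * y ^ k)"
proof -
  let ?F = "\<lambda>z. poly P z / poly Q z"
  define c where "c = (\<lambda>n. (deriv ^^ n) ?F 0 / fact n)"
  have "Q \<noteq> 0"
    using Q[of 0] by auto
  then have fin: "finite {z. poly Q z = 0}"
    by (rule poly_roots_finite)
  define R where "R = Min (insert 2 (norm ` {z. poly Q z = 0}))"
  have "R \<in> insert 2 (norm ` {z. poly Q z = 0})"
    unfolding R_def using fin by (intro Min_in) auto
  then have R: "R > 1"
    using Q by force
  have "poly Q z \<noteq> 0" if "z \<in> ball 0 R" for z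
  proof
    assume "poly Q z = 0"
    then have "R \<le> norm z"
      unfolding R_def using fin by (intro Min_le) auto
    then show False using that by simp
  qed
  then have "?F holomorphic_on ball 0 R"
    by (intro holomorphic_intros) auto
  then have c: "(\<lambda>n. c n * z ^ n) sums ?F z" if "norm z < R" for z
    using holomorphic_power_series[of ?F 0 R z] that by (simp add: c_def)
  have "(\<lambda>n. complex_of_real (f n)) = c"
    using f c R unfolding unit_disc_expansion_def
    by (intro power_series_coeffs_unique[where F = ?F]) auto
  then have fc: "c n = of_real (f n)" for n
    by auto
  define y where "y = (1 + R) / 2"
  have y: "1 < y" "y < (y + R) / 2" "(y + R) / 2 < R"
    using R by (auto simp: y_def field_simps)
  have norms: "norm (complex_of_real ((y + R) / 2)) = (y + R) / 2" "norm (complex_of_real y) = y"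
    using y unfolding norm_of_real by linarith+
  have "summable (\<lambda>n. c n * of_real ((y + R) / 2) ^ n)"
    using y norms by (intro sums_summable[OF c]) simp
  then have "summable (\<lambda>n. norm (c n * of_real y ^ n))"
    by (rule powser_insidea) (use y norms in simp)
  then have "summable (\<lambda>n. \<bar>f n\<bar> * y ^ n)"
    using y by (simp add: fc norm_mult norm_power)
  then show thesis
    using y that by blast
qed

definition upsample :: "nat \<Rightarrow> (nat \<Rightarrow> real) \<Rightarrow> nat \<Rightarrow> real" where
  "upsample s c n = (if s dvd n then c (n div s) else 0)"

text \<open>
The coefficients of \<open>(1 - z) powr (- d)\<close>.
\<close>

definition frac_coeff :: "real \<Rightarrow> nat \<Rightarrow> real" where
  "frac_coeff d j = pochhammer d j / fact j"

lemma frac_coeff_expansion: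
  assumes s: "s \<ge> 1"
  shows "unit_disc_expansion (\<lambda>z. (1 - z ^ s) powr (- complex_of_real d)) (upsample s (frac_coeff d))"
  unfolding unit_disc_expansion_def
proof (intro allI impI)
  fix z :: complex assume z: "norm z < 1"
  \<comment> \<open>The binomial series of \<open>(1 + w) powr (- d)\<close> is used at \<open>w = - (z ^ s)\<close>.\<close>
  have "norm (- (z ^ s)) < 1"
    using z s by (simp add: norm_power power_less_one_iff)
  then have "(\<lambda>n. ((- complex_of_real d) gchoose n) * (- (z ^ s)) ^ n) sums (1 + - (z ^ s)) powr (- of_real d)"
    by (rule gen_binomial_complex)
  also have "(\<lambda>n. ((- complex_of_real d) gchoose n) * (- (z ^ s)) ^ n)
     = (\<lambda>n. of_real (upsample s (frac_coeff d) (s * n)) * z ^ (s * n))"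
  proof
    fix n
    have "(- 1) ^ n * (- (z ^ s)) ^ n = z ^ (s * n)"
      by (simp add: power_mult flip: power_mult_distrib)
    then show "((- complex_of_real d) gchoose n) * (- (z ^ s)) ^ n
      = of_real (upsample s (frac_coeff d) (s * n)) * z ^ (s * n)"
      using s by (simp add: upsample_def frac_coeff_def gbinomial_pochhammer pochhammer_of_real field_simps)
  qed
  finally have "(\<lambda>n. of_real (upsample s (frac_coeff d) (s * n)) * z ^ (s * n)) sums (1 - z ^ s) powr (- of_real d)"
    by simp
  then show "(\<lambda>n. of_real (upsample s (frac_coeff d) n) * z ^ n) sums (1 - z ^ s) powr (- of_real d)"
  proof (subst (asm) sums_mono_reindex)
    show "strict_mono (\<lambda>n. s * n)"
      using s by (auto simp: strict_mono_def)
    show "of_real (upsample s (frac_coeff d) n) * z ^ n = 0" if "n \<notin> range (\<lambda>n. s * n)" for n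
      using that by (auto simp: upsample_def elim: dvdE)
  qed
qed

lemma convolve_causal:
  "convolve (causal c) (causal c') = causal (\<lambda>k. \<Sum>i\<le>k. c i * c' (k - i))"
proof
  fix k :: int
  show "convolve (causal c) (causal c') k = causal (\<lambda>k. \<Sum>i\<le>k. c i * c' (k - i)) k"
  proof (cases "k < 0")
    case True
    then have "causal c i * causal c' (k - i) = 0" for i
      by (auto simp: causal_def)
    with True show ?thesis
      by (simp only: convolve_def infsum_0_simp) (simp add: causal_def)
  next
    case False
    have "convolve (causal c) (causal c') k = (\<Sum>\<^sub>\<infinity>i\<in>int ` {..nat k}. causal c i * causal c' (k - i))"
      unfolding convolve_def
    proof (rule infsum_cong_neutral)
      fix i assume "i \<in> UNIV - int ` {..nat k}"
      then have "i < 0 \<or> k < i"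
        by (metis DiffE atMost_iff image_eqI nat_0_le nat_mono not_less)
      then show "causal c i * causal c' (k - i) = 0"
        by (auto simp: causal_def)
    qed auto
    also have "\<dots> = (\<Sum>i\<in>int ` {..nat k}. causal c i * causal c' (k - i))"
      by simp
    also have "\<dots> = (\<Sum>i\<le>nat k. c i * c' (nat k - i))"
      by (subst sum.reindex) (use False in \<open>auto simp: causal_def nat_diff_distrib intro!: sum.cong\<close>)
    finally show ?thesis
      using False by (simp add: causal_def)
  qed
qed

text \<open>
Two multiples of \<open>s\<close> differ by a multiple of \<open>s\<close>, so at other lags every product vanishes.
\<close>

lemma autocorr_upsample:
  assumes s: "s \<ge> 1" and c: "square_summable (causal c)"
  shows "autocorr (causal (upsample s c)) n
       = (if int s dvd n then autocorr (causal c) (n div int s) else 0)"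
proof -
  let ?u = "causal (upsample s c)"
  have nz: "?u k = 0" if "\<not> int s dvd k" for k
  proof (cases "k < 0")
    case False
    then obtain j where "k = int j"
      by (metis nonneg_int_cases not_less)
    then show ?thesis
      using that by (simp add: causal_def upsample_def)
  qed (simp add: causal_def)
  have mult: "?u (int s * k) = causal c k" for k
    using s by (auto simp: causal_def upsample_def nat_mult_distrib mult_less_0_iff)
  show ?thesis
  proof (cases "int s dvd n")
    case False
    have "?u k * ?u (k + n) = 0" for k
      using False nz[of k] nz[of "k + n"] by (cases "int s dvd k") (auto simp: dvd_add_right_iff)
    then show ?thesis
      using False by (simp only: autocorr_def infsum_0_simp) simp
  next
    case True
    then obtain l where n: "n = int s * l" by blast
    have "((\<lambda>j. causal c j * causal c (j + l)) has_sum autocorr (causal c) l) UNIV"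
      using has_sum_autocorr[OF c, of 0 l] by simp
    then have "((\<lambda>j. ?u (int s * j) * ?u (int s * j + n)) has_sum autocorr (causal c) l) UNIV"
      by (simp add: n mult flip: distrib_left)
    then have "((\<lambda>k. ?u k * ?u (k + n)) has_sum autocorr (causal c) l) (range (\<lambda>j. int s * j))"
      using s by (subst has_sum_reindex) (auto simp: inj_on_def o_def)
    then have "((\<lambda>k. ?u k * ?u (k + n)) has_sum autocorr (causal c) l) UNIV"
      by (rule has_sum_cong_neutral[THEN iffD1, rotated -1])
        (use nz in \<open>auto simp: dvd_def image_def\<close>)
    then show ?thesis
      using s by (simp add: autocorr_def infsumI n)
  qed
qed

lemma upsample_square_summable:
  assumes s: "s \<ge> 1" and c: "summable (\<lambda>k. (c k)\<^sup>2)"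
  shows "summable (\<lambda>k. (upsample s c k)\<^sup>2)"
proof -
  have "(\<lambda>k. (upsample s c (s * k))\<^sup>2) sums (\<Sum>k. (c k)\<^sup>2)"
    using c s by (simp add: upsample_def summable_sums)
  then have "(\<lambda>k. (upsample s c k)\<^sup>2) sums (\<Sum>k. (c k)\<^sup>2)"
  proof (subst (asm) sums_mono_reindex)
    show "strict_mono (\<lambda>n. s * n)"
      using s by (auto simp: strict_mono_def)
    show "(upsample s c n)\<^sup>2 = 0" if "n \<notin> range (\<lambda>n. s * n)" for n
      using that by (auto simp: upsample_def elim: dvdE)
  qed
  then show ?thesis by (rule sums_summable)
qed

section \<open>The fractional coefficients and their autocorrelation\<close>

lemma frac_coeff_square_summable:
  assumes "d < 1 / 2"
  shows "summable (\<lambda>k. (frac_coeff d k)\<^sup>2)"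
proof -
  have "hypergeom_term d d 1 = (\<lambda>k. (frac_coeff d k)\<^sup>2)"
    by (simp add: fun_eq_iff hypergeom_term_def frac_coeff_def power2_eq_square flip: pochhammer_fact)
  then show ?thesis
    using summable_rabs_cancel[OF summable_hypergeom_term[of 1 d d]] assms by simp
qed

text \<open>
The defining series of the autocorrelation is hypergeometric, with parameters \<open>d\<close>, \<open>d + h\<close> and
\<open>h + 1\<close>. The excess \<open>c - a - b\<close> is \<open>1 - 2 * d\<close>, positive because \<open>d < 1 / 2\<close>.
\<close>

lemma frac_autocorr_closed_form:
  assumes d: "d < 1 / 2"
  shows "autocorr (causal (frac_coeff d)) (int h)
       = (- 1) ^ h * Gamma (1 - 2 * d) * rGamma (1 - d + real h) * rGamma (1 - d - real h)"
proof -
  have poch: "pochhammer (real (Suc h)) k * fact h = fact (k + h)" for k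
    by (simp add: pochhammer_fact pochhammer_product' mult.commute add.commute[of k h] add.commute[of 1])
  have term_eq: "frac_coeff d k * frac_coeff d (k + h)
       = pochhammer d h / fact h * hypergeom_term d (d + real h) (real (Suc h)) k" for k
  proof -
    have "pochhammer d (k + h) = pochhammer d h * pochhammer (d + real h) k"
      by (subst add.commute) (rule pochhammer_product')
    then show ?thesis
      by (simp add: frac_coeff_def hypergeom_term_def mult_ac flip: poch del: of_nat_Suc)
  qed
  have "hypergeom_term d (d + real h) (real (Suc h)) sums
      (Gamma (real (Suc h)) * Gamma (real (Suc h) - d - (d + real h)) * rGamma (real (Suc h) - d)
        * rGamma (real (Suc h) - (d + real h)))"
    by (rule gauss_hypergeometric_sum) (use d in auto)
  also have "Gamma (real (Suc h)) = fact h"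
    by (simp add: Gamma_fact add.commute)
  finally have "(\<lambda>k. frac_coeff d k * frac_coeff d (k + h)) sums
      (pochhammer d h / fact h * (fact h * Gamma (1 - 2 * d) * rGamma (1 - d + real h) * rGamma (1 - d)))"
    unfolding term_eq by (intro sums_mult) (simp add: algebra_simps)
  then have "autocorr (causal (frac_coeff d)) (int h)
      = pochhammer d h / fact h * (fact h * Gamma (1 - 2 * d) * rGamma (1 - d + real h) * rGamma (1 - d))"
    using sums_autocorr_causal[OF summable_causal_square[OF frac_coeff_square_summable[OF d]], of h]
    by (rule sums_unique2[rotated])
  also have "\<dots> = Gamma (1 - 2 * d) * rGamma (1 - d + real h) * (pochhammer d h * rGamma (1 - d))"
    by simp
  also have "pochhammer d h * rGamma (1 - d) = (- 1) ^ h * rGamma (1 - d - real h)"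
    using pochhammer_rGamma[of "1 - d - real h" h] pochhammer_minus'[of "- d" h]
    by (simp add: algebra_simps)
  finally show ?thesis
    by (simp only: mult_ac)
qed

lemma frac_autocorr_recurrence:
  assumes d: "d < 1 / 2"
  shows "(real h + 1 - d) * autocorr (causal (frac_coeff d)) (int (Suc h))
       = (real h + d) * autocorr (causal (frac_coeff d)) (int h)"
proof -
  have up: "rGamma (1 - d + real h) = (1 - d + real h) * rGamma (1 - d + real (Suc h))"
    using rGamma_plus1[of "1 - d + real h"] by (simp add: add_ac)
  have down: "rGamma (1 - d - real (Suc h)) = (- d - real h) * rGamma (1 - d - real h)"
    using rGamma_plus1[of "- d - real h"] by (simp add: algebra_simps)
  show ?thesis
    unfolding frac_autocorr_closed_form[OF d] up down by (simp add: algebra_simps)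
qed

lemma gamma_V_eq_autocorr:
  assumes s: "s \<ge> 1" and d: "d < 1 / 2"
  shows "gamma_V s d v (int (s * h)) = v * autocorr (causal (frac_coeff d)) (int h)"
  using s by (simp add: gamma_V_def Let_def frac_autocorr_closed_form[OF d] power_int_of_nat)

lemma frac_autocorr_nonzero:
  assumes d: "d < 1 / 2" "d \<notin> \<int>"
  shows "autocorr (causal (frac_coeff d)) (int h) \<noteq> 0"
proof -
  have "1 - 2 * d \<notin> \<int>\<^sub>\<le>\<^sub>0"
    using d(1) by (auto dest: nonpos_Ints_nonpos)
  moreover have "1 - d + real h \<notin> \<int>\<^sub>\<le>\<^sub>0"
    using d(1) by (auto dest: nonpos_Ints_nonpos)
  moreover have "1 - d - real h \<notin> \<int>\<^sub>\<le>\<^sub>0"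
  proof
    assume "1 - d - real h \<in> \<int>\<^sub>\<le>\<^sub>0"
    then have "1 - d - real h \<in> \<int>"
      by (rule nonpos_Ints_Int)
    then have "1 - real h - (1 - d - real h) \<in> \<int>"
      by (intro Ints_diff) auto
    then show False
      using d(2) by simp
  qed
  ultimately show ?thesis
    by (simp add: frac_autocorr_closed_form[OF d(1)] Gamma_eq_zero_iff rGamma_eq_zero_iff)
qed

lemma frac_autocorr_ratio:
  assumes d: "d < 1 / 2" "d \<notin> \<int>"
  shows "(\<lambda>h. autocorr (causal (frac_coeff d)) (int (Suc h)) / autocorr (causal (frac_coeff d)) (int h))
           \<longlonglongrightarrow> 1"
proof -
  have "autocorr (causal (frac_coeff d)) (int (Suc h)) / autocorr (causal (frac_coeff d)) (int h)
      = (real h + d) / (real h + 1 - d)" for h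
    using frac_autocorr_recurrence[OF d(1), of h] frac_autocorr_nonzero[OF d, of h] d(1)
    by (simp add: field_simps del: of_nat_Suc)
  moreover have "(\<lambda>h. (real h + d) / (real h + 1 - d)) \<longlonglongrightarrow> 1"
    by real_asymp
  ultimately show ?thesis
    by simp
qed

text \<open>
For integer \<open>d\<close>, the argument \<open>1 - d - h\<close> of a reciprocal Gamma factor is eventually a pole of
\<open>Gamma\<close>.
\<close>

lemma frac_autocorr_integer:
  assumes d: "d < 1 / 2" "d \<in> \<int>" and h: "real h > - d"
  shows "autocorr (causal (frac_coeff d)) (int h) = 0"
proof -
  have "1 - d - real h \<in> \<int>"
    using d(2) by simp
  then obtain i where i: "1 - d - real h = of_int i"
    by (elim Ints_cases)
  then have "i < 1"
    using h by linarith
  then have "1 - d - real h \<in> \<int>\<^sub>\<le>\<^sub>0"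
    unfolding i by (simp add: nonpos_Ints_of_int)
  then show ?thesis
    by (simp add: frac_autocorr_closed_form[OF d(1)] rGamma_eq_zero_iff)
qed

section \<open>Sequences whose consecutive ratios tend to 1\<close>

lemma infsum_dominated_convergence:
  fixes F :: "nat \<Rightarrow> 'b \<Rightarrow> real"
  assumes B: "B summable_on UNIV" and bound: "\<And>n x. \<bar>F n x\<bar> \<le> B x"
    and lim: "\<And>x. (\<lambda>n. F n x) \<longlonglongrightarrow> L x"
  shows "(\<lambda>n. infsum (F n) UNIV) \<longlonglongrightarrow> infsum L UNIV"
proof -
  have "Infinite_Set_Sum.abs_summable_on B UNIV"
    using B by (simp add: summable_on_iff_abs_summable_on_real[of B] flip: abs_summable_equivalent)
  then have intB: "integrable (count_space UNIV) B"
    by (simp add: Infinite_Set_Sum.abs_summable_on_def)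
  have "AE x in count_space UNIV. (\<lambda>n. F n x) \<longlonglongrightarrow> L x"
    "\<And>n. AE x in count_space UNIV. norm (F n x) \<le> B x"
    using lim bound by auto
  note dom = integrable_dominated_convergence[OF _ _ intB this]
    integrable_dominated_convergence2[OF _ _ intB this] integral_dominated_convergence[OF _ _ intB this]
  have "integral\<^sup>L (count_space UNIV) g = infsum g UNIV" if "integrable (count_space UNIV) g" for g :: "'b \<Rightarrow> real"
    using infsetsum_infsum[of g UNIV] that by (simp add: Infinite_Set_Sum.abs_summable_on_def infsetsum_def)
  then show ?thesis
    using dom by simp
qed

lemma finite_sum_has_sum:
  fixes f :: "'a \<Rightarrow> 'b \<Rightarrow> real"
  assumes "finite A" "\<And>a. a \<in> A \<Longrightarrow> (f a has_sum S a) B"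
  shows "((\<lambda>x. \<Sum>a\<in>A. f a x) has_sum (\<Sum>a\<in>A. S a)) B"
  using assms by (induction A rule: finite_induct) (auto intro: has_sum_add)

text \<open>
Only finitely many terms violate monotonicity; the constant is the quotient of the maximum and
the minimum of the initial segment.
\<close>

lemma almost_increasing:
  fixes P :: "nat \<Rightarrow> real"
  assumes pos: "\<And>n. P n > 0" and incr: "\<And>n. n \<ge> N \<Longrightarrow> P n \<le> P (Suc n)"
  obtains K where "\<And>i j. i \<le> j \<Longrightarrow> P i \<le> K * P j"
proof -
  define U where "U = Max (P ` {..N})"
  define L where "L = Min (P ` {..N})"
  have U: "P i \<le> U" and L: "L \<le> P i" if "i \<le> N" for i
    using that unfolding U_def L_def by (auto intro!: Max_ge Min_le)
  have "L \<in> P ` {..N}"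
    unfolding L_def by (intro Min_in) auto
  then have L0: "L > 0"
    using pos by auto
  have mono: "P i \<le> P j" if "N \<le> i" "i \<le> j" for i j
    using that(2,1) by (induction rule: dec_induct) (auto intro: order_trans incr)
  have K1: "U / L \<ge> 1"
    using L0 U[of 0] L[of 0] by simp
  have "P i \<le> (U / L) * P j" if "i \<le> j" for i j
  proof (cases "i \<le> N")
    case True
    have "L \<le> P j"
      using L[of j] L[of N] mono[of N j] by (cases "j \<le> N") auto
    then have "(U / L) * L \<le> (U / L) * P j"
      using K1 by (intro mult_left_mono) auto
    then show ?thesis
      using U[OF True] L0 by simp
  next
    case False
    then have "P i \<le> P j"
      using that by (intro mono) auto
    also have "\<dots> \<le> (U / L) * P j"
      using mult_right_mono[OF K1, of "P j"] pos[of j] by simp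
    finally show ?thesis .
  qed
  then show thesis by (rule that)
qed

text \<open>
Since the ratios tend to 1, eventually \<open>\<bar>c n\<bar> * y ^ n\<close> and \<open>y ^ n / \<bar>c n\<bar>\<close> are both
increasing. The first bounds \<open>c i\<close> by a later \<open>c j\<close>, the second by an earlier one.
\<close>

lemma subexponential_variation:
  fixes c :: "nat \<Rightarrow> real"
  assumes nz: "\<And>n. c n \<noteq> 0" and ratio: "(\<lambda>n. c (Suc n) / c n) \<longlonglongrightarrow> 1" and y: "y > 1"
  obtains K where "\<And>i j. \<bar>c i\<bar> \<le> K * y ^ nat \<bar>int i - int j\<bar> * \<bar>c j\<bar>"
proof -
  have "(\<lambda>n. \<bar>c (Suc n) / c n\<bar>) \<longlonglongrightarrow> \<bar>1\<bar>"
    by (intro tendsto_intros ratio)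
  then have r: "(\<lambda>n. \<bar>c (Suc n) / c n\<bar>) \<longlonglongrightarrow> 1"
    by simp
  have "1 / y < 1"
    using y by simp
  from eventually_conj[OF order_tendstoD(1)[OF r this] order_tendstoD(2)[OF r y]]
  obtain N where N: "1 / y < \<bar>c (Suc n) / c n\<bar>" "\<bar>c (Suc n) / c n\<bar> < y" if "n \<ge> N" for n
    unfolding eventually_at_top_linorder by auto
  have N': "\<bar>c n\<bar> \<le> y * \<bar>c (Suc n)\<bar>" "\<bar>c (Suc n)\<bar> \<le> y * \<bar>c n\<bar>" if "n \<ge> N" for n
    using N[OF that] nz[of n] nz[of "Suc n"] y by (auto simp: field_simps abs_divide)
  obtain K1 where K1: "\<And>i j. i \<le> j \<Longrightarrow> \<bar>c i\<bar> * y ^ i \<le> K1 * (\<bar>c j\<bar> * y ^ j)"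
  proof (rule almost_increasing[where P = "\<lambda>n. \<bar>c n\<bar> * y ^ n" and N = N])
    show "\<bar>c n\<bar> * y ^ n \<le> \<bar>c (Suc n)\<bar> * y ^ Suc n" if "n \<ge> N" for n
      using mult_right_mono[OF N'(1)[OF that], of "y ^ n"] y by (simp add: mult_ac)
  qed (use nz y in auto)
  obtain K2 where K2: "\<And>i j. i \<le> j \<Longrightarrow> y ^ i / \<bar>c i\<bar> \<le> K2 * (y ^ j / \<bar>c j\<bar>)"
  proof (rule almost_increasing[where P = "\<lambda>n. y ^ n / \<bar>c n\<bar>" and N = N])
    show "y ^ n / \<bar>c n\<bar> \<le> y ^ Suc n / \<bar>c (Suc n)\<bar>" if "n \<ge> N" for n
      using mult_right_mono[OF N'(2)[OF that], of "y ^ n"] y nz[of n] nz[of "Suc n"] by (simp add: field_simps)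
  qed (use nz y in auto)
  have "\<bar>c i\<bar> \<le> max K1 K2 * y ^ nat \<bar>int i - int j\<bar> * \<bar>c j\<bar>" for i j
  proof (cases "i \<le> j")
    case True
    have "y ^ j = y ^ i * y ^ (j - i)"
      using True by (simp flip: power_add)
    then have "\<bar>c i\<bar> * y ^ i \<le> (K1 * (\<bar>c j\<bar> * y ^ (j - i))) * y ^ i"
      using K1[OF True] by (simp add: mult_ac)
    then have "\<bar>c i\<bar> \<le> K1 * (\<bar>c j\<bar> * y ^ (j - i))"
      using y by simp
    also have "\<dots> \<le> max K1 K2 * (\<bar>c j\<bar> * y ^ (j - i))"
      using y by (intro mult_right_mono) auto
    also have "j - i = nat \<bar>int i - int j\<bar>"
      using True by auto
    finally show ?thesis
      by (simp only: mult_ac)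
  next
    case False
    then have ji: "j \<le> i" by simp
    have "y ^ i = y ^ j * y ^ (i - j)"
      using ji by (simp flip: power_add)
    then have "y ^ j * \<bar>c i\<bar> \<le> y ^ j * (K2 * (\<bar>c j\<bar> * y ^ (i - j)))"
      using K2[OF ji] nz[of i] nz[of j] by (simp add: field_simps)
    then have "\<bar>c i\<bar> \<le> K2 * (\<bar>c j\<bar> * y ^ (i - j))"
      using y by simp
    also have "\<dots> \<le> max K1 K2 * (\<bar>c j\<bar> * y ^ (i - j))"
      using y by (intro mult_right_mono) auto
    also have "i - j = nat \<bar>int i - int j\<bar>"
      using ji by auto
    finally show ?thesis
      by (simp only: mult_ac)
  qed
  then show thesis by (rule that)
qed

lemma ratio_tendsto_shift:
  fixes c :: "nat \<Rightarrow> real"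
  assumes nz: "\<And>n. c n \<noteq> 0" and ratio: "(\<lambda>n. c (Suc n) / c n) \<longlonglongrightarrow> 1"
  shows "(\<lambda>h. c (nat \<bar>int h + m\<bar>) / c h) \<longlonglongrightarrow> 1"
proof -
  have fwd: "(\<lambda>h. c (h + k) / c h) \<longlonglongrightarrow> 1" for k
  proof (induction k)
    case (Suc k)
    have "(\<lambda>h. c (Suc (h + k)) / c (h + k) * (c (h + k) / c h)) \<longlonglongrightarrow> 1 * 1"
      by (intro tendsto_mult Suc.IH LIMSEQ_ignore_initial_segment ratio)
    then show ?case
      using nz by simp
  qed (use nz in simp)
  show ?thesis
  proof (cases "m \<ge> 0")
    case True
    then have "nat \<bar>int h + m\<bar> = h + nat m" for h
      by auto
    then show ?thesis
      using fwd[of "nat m"] by simp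
  next
    case False
    let ?k = "nat (- m)"
    have "(\<lambda>h. inverse (c (h + ?k) / c h)) \<longlonglongrightarrow> inverse 1"
      by (intro tendsto_inverse fwd) simp
    moreover have "inverse (c (h + ?k) / c h) = c (nat \<bar>int (h + ?k) + m\<bar>) / c (h + ?k)" for h
    proof -
      have "nat \<bar>int (h + ?k) + m\<bar> = h"
        using False by simp
      then show ?thesis by simp
    qed
    ultimately have "(\<lambda>h. c (nat \<bar>int (h + ?k) + m\<bar>) / c (h + ?k)) \<longlonglongrightarrow> 1"
      by (simp only: inverse_1)
    then show ?thesis
      by (rule LIMSEQ_offset)
  qed
qed

section \<open>Autocorrelation of a filtered seasonal sequence\<close>

text \<open>
The only surviving index is \<open>r = - n mod s\<close>, and \<open>- (- n div s)\<close> is \<open>n / s\<close> rounded up.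
\<close>

lemma sum_one_period:
  fixes g :: "int \<Rightarrow> real"
  assumes s: "s \<ge> 1"
  shows "(\<Sum>r = 0..<s. if int s dvd n + int r then g ((n + int r) div int s) else 0)
       = g (- (- n div int s))"
proof -
  define r where "r = nat (- n mod int s)"
  have r: "r < s" "int r = - n mod int s"
    using s by (auto simp: r_def nat_less_iff)
  have n: "n + int r = int s * - (- n div int s)"
    using mult_div_mod_eq[of "int s" "- n"] unfolding r(2) mult_minus_right by linarith
  have "int s dvd n + int r' \<longleftrightarrow> r' = r" if "r' < s" for r'
  proof
    assume "int s dvd n + int r'"
    then have "int r' mod int s = - n mod int s"
      by (metis add.commute diff_minus_eq_add mod_eq_dvd_iff)
    then show "r' = r"
      using that r by simp
  qed (simp add: n)
  then have "(\<Sum>r' = 0..<s. if int s dvd n + int r' then g ((n + int r') div int s) else 0)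
      = (\<Sum>r' = 0..<s. if r' = r then g ((n + int r) div int s) else 0)"
    by (intro sum.cong) auto
  also have "\<dots> = g ((n + int r) div int s)"
    using r(1) by simp
  also have "(n + int r) div int s = - (- n div int s)"
    unfolding n using s by (intro nonzero_mult_div_cancel_left) simp
  finally show ?thesis .
qed

lemma weighted_causal_summable:
  assumes "summable (\<lambda>k. \<bar>f k\<bar> * y ^ k)" "y \<ge> 1"
  shows "(\<lambda>i. \<bar>causal f i\<bar> * y ^ nat \<bar>i\<bar>) summable_on UNIV"
    and "(\<lambda>i. \<bar>causal f i\<bar>) summable_on UNIV"
proof -
  have "(\<lambda>k. \<bar>f k\<bar> * y ^ k) summable_on UNIV"
    using assms by (simp add: summable_on_UNIV_nonneg_real_iff)
  then obtain S where "((\<lambda>k. \<bar>causal f (int k)\<bar> * y ^ nat \<bar>int k\<bar>) has_sum S) UNIV"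
    by (auto simp: causal_def summable_on_def)
  then have "((\<lambda>i. \<bar>causal f i\<bar> * y ^ nat \<bar>i\<bar>) has_sum S) UNIV"
    by (subst causal_reindex) (auto simp: causal_def)
  then show 1: "(\<lambda>i. \<bar>causal f i\<bar> * y ^ nat \<bar>i\<bar>) summable_on UNIV"
    by (rule has_sum_imp_summable)
  have "\<bar>causal f i\<bar> * 1 \<le> \<bar>causal f i\<bar> * y ^ nat \<bar>i\<bar>" for i
    using assms(2) by (intro mult_left_mono one_le_power) auto
  then show "(\<lambda>i. \<bar>causal f i\<bar>) summable_on UNIV"
    by (intro summable_on_comparison_test[OF 1]) auto
qed

text \<open>
Let \<open>w = causal f\<close>. After division by \<open>c h\<close>, the term of the double series belonging to
\<open>(i, j)\<close> tends to \<open>w i * w j\<close>. By \<open>subexponential_variation\<close> it is bounded by a constant times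
\<open>\<bar>w i\<bar> * y ^ \<bar>i\<bar> * (\<bar>w j\<bar> * y ^ \<bar>j\<bar>)\<close>, which is summable; hence dominated convergence applies.
\<close>

lemma period_sum_autocorr_asymptotic:
  fixes f c :: "nat \<Rightarrow> real" and u :: "int \<Rightarrow> real"
  assumes s: "s \<ge> 1" and y: "y > 1" and f: "summable (\<lambda>k. \<bar>f k\<bar> * y ^ k)"
    and u: "square_summable u"
    and corr: "\<And>n. autocorr u n = (if int s dvd n then c (nat \<bar>n div int s\<bar>) else 0)"
    and nz: "\<And>n. c n \<noteq> 0" and ratio: "(\<lambda>n. c (Suc n) / c n) \<longlonglongrightarrow> 1"
  shows "(\<lambda>h. (\<Sum>r = 0..<s. autocorr (convolve (causal f) u) (int (s * h + r))) / c h)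
           \<longlonglongrightarrow> (infsum (causal f) UNIV)\<^sup>2"
proof -
  define w where "w = causal f"
  note w = weighted_causal_summable[OF f less_imp_le[OF y], folded w_def]
  define m where "m = (\<lambda>i j :: int. - (- (i - j) div int s))"
  define F where "F = (\<lambda>h (i, j). w i * w j * (c (nat \<bar>int h + m i j\<bar>) / c h))"
  obtain K where K: "\<And>i j. \<bar>c i\<bar> \<le> K * y ^ nat \<bar>int i - int j\<bar> * \<bar>c j\<bar>"
    using subexponential_variation[OF nz ratio y] by blast
  have K0: "K \<ge> 0"
    using K[of 0 0] nz[of 0] by (auto simp: mult_le_cancel_right1)
  have ww: "((\<lambda>(i, j). w i * w j) has_sum (infsum w UNIV)\<^sup>2) UNIV"
    using has_sum_mult_real[OF has_sum_infsum[OF summable_on_rabs_cancel[OF w(2)]]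
        has_sum_infsum[OF summable_on_rabs_cancel[OF w(2)]]] by (simp add: power2_eq_square)
  have period: "(\<Sum>r = 0..<s. autocorr u (int (s * h + r) + i - j)) = c (nat \<bar>int h + m i j\<bar>)" for h i j
  proof -
    have "(\<Sum>r = 0..<s. autocorr u (int (s * h + r) + i - j))
      = (\<Sum>r = 0..<s. if int s dvd (int s * int h + (i - j)) + int r
           then c (nat \<bar>((int s * int h + (i - j)) + int r) div int s\<bar>) else 0)"
      by (intro sum.cong refl) (simp add: corr algebra_simps)
    also have "\<dots> = c (nat \<bar>- (- (int s * int h + (i - j)) div int s)\<bar>)"
      by (rule sum_one_period[OF s])
    also have "- (int s * int h + (i - j)) = - (i - j) + int s * (- int h)"
      by simp
    also have "- ((- (i - j) + int s * (- int h)) div int s) = int h + m i j"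
      using s by (subst div_mult_self2) (auto simp: m_def)
    finally show ?thesis .
  qed
  have sum_eq: "(\<Sum>r = 0..<s. autocorr (convolve w u) (int (s * h + r))) / c h = infsum (F h) UNIV" for h
  proof -
    let ?R = "\<lambda>r (i, j). w i * w j * autocorr u (int (s * h + r) + i - j)"
    have R: "(?R r has_sum autocorr (convolve w u) (int (s * h + r))) UNIV" for r
      using summable_autocorr_convolve[OF w(2) u, THEN has_sum_infsum]
      by (simp add: autocorr_def[of "convolve w u"] infsumI[OF has_sum_autocorr_convolve[OF w(2) u]])
    have "((\<lambda>p. (\<Sum>r = 0..<s. ?R r p) / c h) has_sum
        (\<Sum>r = 0..<s. autocorr (convolve w u) (int (s * h + r))) / c h) UNIV"
      by (intro has_sum_divide_const finite_sum_has_sum R) auto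
    also have "(\<lambda>p. (\<Sum>r = 0..<s. ?R r p) / c h) = F h"
      by (auto simp: F_def fun_eq_iff simp flip: period sum_distrib_left)
    finally show ?thesis
      by (rule infsumI[symmetric])
  qed
  have m_le: "\<bar>m i j\<bar> \<le> \<bar>i\<bar> + \<bar>j\<bar>" for i j
  proof -
    have "\<bar>(- (i - j)) div int s\<bar> \<le> \<bar>i - j\<bar>"
    proof (cases "- (i - j) \<ge> 0")
      case True
      then show ?thesis
        using s zdiv_mono2[of "- (i - j)" 1 "int s"] pos_imp_zdiv_nonneg_iff[of "int s" "- (i - j)"] by auto
    next
      case False
      then show ?thesis
        using s zdiv_mono2_neg[of "- (i - j)" 1 "int s"] pos_imp_zdiv_neg_iff[of "int s" "- (i - j)"] by auto
    qed
    then show ?thesis by (auto simp: m_def)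
  qed
  have "(\<lambda>h. infsum (F h) UNIV) \<longlonglongrightarrow> (\<Sum>\<^sub>\<infinity>(i, j). w i * w j)"
  proof (rule infsum_dominated_convergence)
    have "(\<lambda>(i, j). (\<bar>w i\<bar> * y ^ nat \<bar>i\<bar>) * (\<bar>w j\<bar> * y ^ nat \<bar>j\<bar>)) summable_on UNIV"
      using has_sum_mult_real[OF has_sum_infsum[OF w(1)] has_sum_infsum[OF w(1)]]
      by (auto intro: has_sum_imp_summable)
    then show "(\<lambda>p. K * (case p of (i, j) \<Rightarrow> (\<bar>w i\<bar> * y ^ nat \<bar>i\<bar>) * (\<bar>w j\<bar> * y ^ nat \<bar>j\<bar>))) summable_on UNIV"
      by (rule summable_on_cmult_right)
    show "\<bar>F h p\<bar> \<le> K * (case p of (i, j) \<Rightarrow> (\<bar>w i\<bar> * y ^ nat \<bar>i\<bar>) * (\<bar>w j\<bar> * y ^ nat \<bar>j\<bar>))" for h p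
    proof -
      obtain i j where p: "p = (i, j)" by force
      let ?k = "nat \<bar>int h + m i j\<bar>"
      have "\<bar>c ?k\<bar> \<le> K * y ^ nat \<bar>int ?k - int h\<bar> * \<bar>c h\<bar>"
        by (rule K)
      then have "\<bar>c ?k / c h\<bar> \<le> K * y ^ nat \<bar>int ?k - int h\<bar>"
        using nz[of h] by (simp add: abs_divide field_simps)
      also have "\<dots> \<le> K * y ^ (nat \<bar>i\<bar> + nat \<bar>j\<bar>)"
      proof (intro mult_left_mono power_increasing K0)
        show "nat \<bar>int ?k - int h\<bar> \<le> nat \<bar>i\<bar> + nat \<bar>j\<bar>"
          using m_le[of i j] by linarith
      qed (use y in auto)
      finally have "\<bar>w i * w j\<bar> * \<bar>c ?k / c h\<bar> \<le> \<bar>w i * w j\<bar> * (K * y ^ (nat \<bar>i\<bar> + nat \<bar>j\<bar>))"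
        by (intro mult_left_mono) auto
      then show ?thesis
        by (simp add: p F_def abs_mult power_add mult_ac)
    qed
    show "(\<lambda>h. F h p) \<longlonglongrightarrow> (case p of (i, j) \<Rightarrow> w i * w j)" for p
    proof -
      obtain i j where p: "p = (i, j)" by force
      have "(\<lambda>h. w i * w j * (c (nat \<bar>int h + m i j\<bar>) / c h)) \<longlonglongrightarrow> w i * w j * 1"
        by (intro tendsto_mult tendsto_const ratio_tendsto_shift nz ratio)
      then show ?thesis
        by (simp add: p F_def)
    qed
  qed
  then show ?thesis
    using infsumI[OF ww] by (simp only: sum_eq flip: w_def)
qed

text \<open>
Let \<open>w = causal f\<close>. A term \<open>w i * w j * autocorr u (n + i - j)\<close> can only be nonzero if
\<open>n \<le> D + \<bar>i\<bar> + \<bar>j\<bar>\<close>, and then the weights \<open>y ^ \<bar>i\<bar>\<close> and \<open>y ^ \<bar>j\<bar>\<close> pay for the factor \<open>y ^ n\<close>.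
\<close>

lemma autocorr_convolve_exponential_decay:
  fixes f :: "nat \<Rightarrow> real" and u :: "int \<Rightarrow> real"
  assumes y: "y > 1" and f: "summable (\<lambda>k. \<bar>f k\<bar> * y ^ k)"
    and u: "square_summable u"
    and finite_range: "\<And>n. n > int D \<Longrightarrow> autocorr u n = 0"
  obtains C where "\<And>n. \<bar>autocorr (convolve (causal f) u) (int n)\<bar> \<le> C / y ^ n"
proof -
  define w where "w = causal f"
  note w = weighted_causal_summable[OF f less_imp_le[OF y], folded w_def]
  let ?B = "\<Sum>\<^sub>\<infinity>k. (u k)\<^sup>2"
  let ?g = "\<lambda>(i, j). (\<bar>w i\<bar> * y ^ nat \<bar>i\<bar>) * (\<bar>w j\<bar> * y ^ nat \<bar>j\<bar>)"
  have B0: "?B \<ge> 0"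
    by (intro infsum_nonneg) auto
  have g: "?g summable_on UNIV"
    using has_sum_mult_real[OF has_sum_infsum[OF w(1)] has_sum_infsum[OF w(1)]]
    by (auto intro: has_sum_imp_summable)
  have "\<bar>autocorr (convolve w u) (int n)\<bar> \<le> (?B * y ^ D * infsum ?g UNIV) / y ^ n" for n
  proof -
    let ?R = "\<lambda>(i, j). w i * w j * autocorr u (int n + i - j)"
    have term_le: "\<bar>?R (i, j)\<bar> \<le> (?B * y ^ D / y ^ n) * ?g (i, j)" for i j
    proof (cases "int n + i - j > int D")
      case True
      then show ?thesis
        using finite_range y B0 by simp
    next
      case False
      then have "n \<le> D + (nat \<bar>i\<bar> + nat \<bar>j\<bar>)" by linarith
      then have "y ^ n \<le> y ^ (D + (nat \<bar>i\<bar> + nat \<bar>j\<bar>))"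
        using y by (intro power_increasing) auto
      then have "1 \<le> y ^ D / y ^ n * (y ^ nat \<bar>i\<bar> * y ^ nat \<bar>j\<bar>)"
        using y by (simp add: power_add field_simps)
      then have "\<bar>autocorr u (int n + i - j)\<bar> * 1 \<le> ?B * (y ^ D / y ^ n * (y ^ nat \<bar>i\<bar> * y ^ nat \<bar>j\<bar>))"
        using y B0 by (intro mult_mono autocorr_bounded[OF u]) auto
      then have "\<bar>w i * w j\<bar> * \<bar>autocorr u (int n + i - j)\<bar>
          \<le> \<bar>w i * w j\<bar> * (?B * (y ^ D / y ^ n * (y ^ nat \<bar>i\<bar> * y ^ nat \<bar>j\<bar>)))"
        by (intro mult_left_mono) auto
      then show ?thesis
        by (simp add: abs_mult mult_ac)
    qed
    have abs_R: "(\<lambda>p. \<bar>?R p\<bar>) summable_on UNIV"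
      by (rule summable_on_comparison_test[OF summable_on_cmult_right[OF g, of "?B * y ^ D / y ^ n"]])
        (use term_le in auto)
    have "autocorr (convolve w u) (int n) = infsum ?R UNIV"
      unfolding autocorr_def[of "convolve w u"] by (rule infsumI[OF has_sum_autocorr_convolve[OF w(2) u]])
    then have "\<bar>autocorr (convolve w u) (int n)\<bar> \<le> (\<Sum>\<^sub>\<infinity>p. \<bar>?R p\<bar>)"
      using norm_infsum_bound[of ?R UNIV] abs_R by simp
    also have "\<dots> \<le> (\<Sum>\<^sub>\<infinity>p. (?B * y ^ D / y ^ n) * ?g p)"
      by (intro infsum_mono abs_R summable_on_cmult_right g) (use term_le in auto)
    also have "\<dots> = (?B * y ^ D / y ^ n) * infsum ?g UNIV"
      by (rule infsum_cmult_right')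
    finally show ?thesis
      by simp
  qed
  then show thesis
    by (rule that[unfolded w_def[symmetric]])
qed

section \<open>Linear processes driven by white noise\<close>

definition (in prob_space) square_integrable :: "('a \<Rightarrow> real) \<Rightarrow> bool" where
  "square_integrable f \<longleftrightarrow> f \<in> borel_measurable M \<and> integrable M (\<lambda>x. (f x)\<^sup>2)"

context prob_space
begin

lemma square_integrable_mult:
  assumes "square_integrable f" "square_integrable g"
  shows "integrable M (\<lambda>x. f x * g x)"
proof (rule Bochner_Integration.integrable_bound)
  show "integrable M (\<lambda>x. ((f x)\<^sup>2 + (g x)\<^sup>2) / 2)"
    using assms by (auto simp: square_integrable_def)
  show "AE x in M. norm (f x * g x) \<le> norm (((f x)\<^sup>2 + (g x)\<^sup>2) / 2)"
    using abs_mult_le_squares by (auto intro!: AE_I2)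
qed (use assms in \<open>auto simp: square_integrable_def\<close>)

lemma square_integrable_const [simp]: "square_integrable (\<lambda>_. c)"
  by (simp add: square_integrable_def)

lemma square_integrable_integrable:
  assumes "square_integrable f"
  shows "integrable M f"
  using square_integrable_mult[OF assms square_integrable_const[of 1]] by simp

lemma square_integrable_cmult:
  assumes "square_integrable f"
  shows "square_integrable (\<lambda>x. c * f x)"
  using assms by (auto simp: square_integrable_def power_mult_distrib)

lemma square_integrable_add:
  assumes f: "square_integrable f" and g: "square_integrable g"
  shows "square_integrable (\<lambda>x. f x + g x)"
proof -
  have "integrable M (\<lambda>x. (f x)\<^sup>2 + (g x)\<^sup>2 + 2 * (f x * g x))"
    using assms square_integrable_mult[OF f g]
    by (intro Bochner_Integration.integrable_add integrable_mult_right) (auto simp: square_integrable_def)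
  then show ?thesis
    using assms by (auto simp: square_integrable_def power2_sum algebra_simps)
qed

lemma square_integrable_diff:
  assumes f: "square_integrable f" and g: "square_integrable g"
  shows "square_integrable (\<lambda>x. f x - g x)"
  using square_integrable_add[OF f square_integrable_cmult[OF g, of "- 1"]] by simp

lemma square_integrable_sum:
  assumes "\<And>k. k \<in> A \<Longrightarrow> square_integrable (f k)"
  shows "square_integrable (\<lambda>x. \<Sum>k\<in>A. f k x)"
  using assms by (induction A rule: infinite_finite_induct) (auto intro: square_integrable_add)

lemma expectation_Cauchy_Schwarz:
  assumes f: "square_integrable f" and g: "square_integrable g"
  shows "\<bar>expectation (\<lambda>x. f x * g x)\<bar> \<le> sqrt (expectation (\<lambda>x. (f x)\<^sup>2)) * sqrt (expectation (\<lambda>x. (g x)\<^sup>2))"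
proof -
  define A B C where "A = expectation (\<lambda>x. (f x)\<^sup>2)" and "B = expectation (\<lambda>x. f x * g x)"
    and "C = expectation (\<lambda>x. (g x)\<^sup>2)"
  have fg: "integrable M (\<lambda>x. f x * g x)"
    by (rule square_integrable_mult[OF f g])
  \<comment> \<open>This quadratic polynomial is the second moment of \<open>g - c * f\<close>.\<close>
  have quad: "0 \<le> C - 2 * c * B + c\<^sup>2 * A" for c
  proof -
    have "0 \<le> expectation (\<lambda>x. (g x - c * f x)\<^sup>2)"
      by (intro Bochner_Integration.integral_nonneg) auto
    also have "(\<lambda>x. (g x - c * f x)\<^sup>2) = (\<lambda>x. (g x)\<^sup>2 - 2 * c * (f x * g x) + c\<^sup>2 * (f x)\<^sup>2)"
      by (auto simp: power2_eq_square algebra_simps)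
    also have "expectation \<dots> = C - 2 * c * B + c\<^sup>2 * A"
      using f g fg by (simp add: A_def B_def C_def square_integrable_def)
    finally show ?thesis .
  qed
  have A0: "A \<ge> 0"
    unfolding A_def by (intro Bochner_Integration.integral_nonneg) auto
  have "B\<^sup>2 \<le> A * C"
  proof (cases "A = 0")
    case True
    have "B = 0"
    proof (rule ccontr)
      assume "B \<noteq> 0"
      then show False
        using quad[of "(C + 1) / (2 * B)"] True by (simp add: field_simps)
    qed
    with True show ?thesis by simp
  next
    case False
    then have "A > 0" using A0 by simp
    have "C - 2 * (B / A) * B + (B / A)\<^sup>2 * A = C - B\<^sup>2 / A"
      using False by (simp add: power2_eq_square field_simps)
    then have "B\<^sup>2 / A \<le> C"
      using quad[of "B / A"] by simp
    then show ?thesis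
      using \<open>A > 0\<close> by (simp add: field_simps)
  qed
  then have "\<bar>B\<bar> \<le> sqrt (A * C)"
    by (rule real_le_rsqrt[OF order_trans[rotated]]) simp
  then show ?thesis
    by (simp add: A_def B_def C_def real_sqrt_mult)
qed

text \<open>
By Fatou's lemma, the almost sure limit of a sequence that is Cauchy in mean square is also its
limit in mean square, with the same rate.
\<close>

lemma L2_limit_of_Cauchy:
  fixes W :: "nat \<Rightarrow> 'a \<Rightarrow> real"
  assumes W: "\<And>N. square_integrable (W N)" and S [measurable]: "S \<in> borel_measurable M"
    and lim: "AE x in M. (\<lambda>N. W N x) \<longlonglongrightarrow> S x"
    and Cauchy: "\<And>N N'. N \<le> N' \<Longrightarrow> expectation (\<lambda>x. (W N' x - W N x)\<^sup>2) \<le> \<epsilon> N"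
  shows "square_integrable S" and "expectation (\<lambda>x. (S x - W N x)\<^sup>2) \<le> \<epsilon> N"
proof -
  have [measurable]: "W N \<in> borel_measurable M" for N
    using W by (simp add: square_integrable_def)
  have eps: "0 \<le> \<epsilon> N" for N
    using Cauchy[of N N] by simp
  have bound: "(\<integral>\<^sup>+x. ennreal ((S x - W N x)\<^sup>2) \<partial>M) \<le> ennreal (\<epsilon> N)" for N
  proof -
    have "(\<integral>\<^sup>+x. ennreal ((S x - W N x)\<^sup>2) \<partial>M) = (\<integral>\<^sup>+x. liminf (\<lambda>N'. ennreal ((W N' x - W N x)\<^sup>2)) \<partial>M)"
    proof (rule nn_integral_cong_AE)
      show "AE x in M. ennreal ((S x - W N x)\<^sup>2) = liminf (\<lambda>N'. ennreal ((W N' x - W N x)\<^sup>2))"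
        using lim
      proof eventually_elim
        case (elim x)
        have "(\<lambda>N'. ennreal ((W N' x - W N x)\<^sup>2)) \<longlonglongrightarrow> ennreal ((S x - W N x)\<^sup>2)"
          by (intro tendsto_intros tendsto_ennrealI elim)
        then show ?case
          by (intro lim_imp_Liminf[symmetric]) simp_all
      qed
    qed
    also have "\<dots> \<le> liminf (\<lambda>N'. \<integral>\<^sup>+x. ennreal ((W N' x - W N x)\<^sup>2) \<partial>M)"
      by (intro nn_integral_liminf) auto
    also have "\<dots> \<le> limsup (\<lambda>N'. \<integral>\<^sup>+x. ennreal ((W N' x - W N x)\<^sup>2) \<partial>M)"
      by (intro Liminf_le_Limsup) auto
    also have "\<dots> \<le> ennreal (\<epsilon> N)"
    proof (rule Limsup_bounded)
      show "\<forall>\<^sub>F N' in sequentially. (\<integral>\<^sup>+x. ennreal ((W N' x - W N x)\<^sup>2) \<partial>M) \<le> ennreal (\<epsilon> N)"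
        using eventually_ge_at_top[of N]
      proof eventually_elim
        case (elim N')
        have "integrable M (\<lambda>x. (W N' x - W N x)\<^sup>2)"
          using square_integrable_diff[OF W W, of N' N] by (simp add: square_integrable_def)
        then have "(\<integral>\<^sup>+x. ennreal ((W N' x - W N x)\<^sup>2) \<partial>M) = ennreal (expectation (\<lambda>x. (W N' x - W N x)\<^sup>2))"
          by (intro nn_integral_eq_integral) auto
        also have "\<dots> \<le> ennreal (\<epsilon> N)"
          by (intro ennreal_leI Cauchy elim)
        finally show ?case .
      qed
    qed
    finally show ?thesis .
  qed
  have int: "integrable M (\<lambda>x. (S x - W N x)\<^sup>2)" for N
    by (rule integrableI_nonneg) (use bound[of N] in \<open>auto intro: le_less_trans\<close>)
  show "expectation (\<lambda>x. (S x - W N x)\<^sup>2) \<le> \<epsilon> N"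
    using bound[of N] nn_integral_eq_integral[OF int[of N]] eps[of N] by simp
  have "square_integrable (\<lambda>x. S x - W 0 x)"
    using int[of 0] by (simp add: square_integrable_def)
  from square_integrable_add[OF this W[of 0]] show "square_integrable S"
    by simp
qed

lemma expectation_mult_L2_tendsto:
  assumes W: "\<And>N. square_integrable (W N)" "square_integrable S"
    and V: "\<And>N. square_integrable (V N)" "square_integrable T"
    and limW: "(\<lambda>N :: nat. expectation (\<lambda>x. (S x - W N x)\<^sup>2)) \<longlonglongrightarrow> 0"
    and limV: "(\<lambda>N. expectation (\<lambda>x. (T x - V N x)\<^sup>2)) \<longlonglongrightarrow> 0"
  shows "(\<lambda>N. expectation (\<lambda>x. W N x * V N x)) \<longlonglongrightarrow> expectation (\<lambda>x. S x * T x)"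
proof -
  let ?E = "\<lambda>f. sqrt (expectation (\<lambda>x. (f x)\<^sup>2))"
  let ?a = "\<lambda>N. expectation (\<lambda>x. (S x - W N x) * T x)"
  let ?b = "\<lambda>N. expectation (\<lambda>x. S x * (T x - V N x))"
  let ?c = "\<lambda>N. expectation (\<lambda>x. (S x - W N x) * (T x - V N x))"
  have W0: "(\<lambda>N. ?E (\<lambda>x. S x - W N x)) \<longlonglongrightarrow> 0" and V0: "(\<lambda>N. ?E (\<lambda>x. T x - V N x)) \<longlonglongrightarrow> 0"
    using tendsto_real_sqrt[OF limW] tendsto_real_sqrt[OF limV] by simp_all
  have dW: "square_integrable (\<lambda>x. S x - W N x)" and dV: "square_integrable (\<lambda>x. T x - V N x)" for N
    by (intro square_integrable_diff W V)+
  have "?a \<longlonglongrightarrow> 0"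
  proof (rule tendsto_rabs_zero_cancel, rule tendsto_sandwich[OF _ _ tendsto_const])
    show "(\<lambda>N. ?E (\<lambda>x. S x - W N x) * ?E T) \<longlonglongrightarrow> 0"
      using tendsto_mult_right[OF W0] by simp
  qed (use expectation_Cauchy_Schwarz[OF dW V(2)] in auto)
  moreover have "?b \<longlonglongrightarrow> 0"
  proof (rule tendsto_rabs_zero_cancel, rule tendsto_sandwich[OF _ _ tendsto_const])
    show "(\<lambda>N. ?E S * ?E (\<lambda>x. T x - V N x)) \<longlonglongrightarrow> 0"
      using tendsto_mult_left[OF V0] by simp
  qed (use expectation_Cauchy_Schwarz[OF W(2) dV] in auto)
  moreover have "?c \<longlonglongrightarrow> 0"
  proof (rule tendsto_rabs_zero_cancel, rule tendsto_sandwich[OF _ _ tendsto_const])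
    show "(\<lambda>N. ?E (\<lambda>x. S x - W N x) * ?E (\<lambda>x. T x - V N x)) \<longlonglongrightarrow> 0"
      using tendsto_mult[OF W0 V0] by simp
  qed (use expectation_Cauchy_Schwarz[OF dW dV] in auto)
  ultimately have "(\<lambda>N. expectation (\<lambda>x. S x * T x) - ?a N - ?b N + ?c N)
      \<longlonglongrightarrow> expectation (\<lambda>x. S x * T x) - 0 - 0 + 0"
    by (intro tendsto_intros)
  moreover have "expectation (\<lambda>x. S x * T x) - ?a N - ?b N + ?c N = expectation (\<lambda>x. W N x * V N x)" for N
  proof -
    have "expectation (\<lambda>x. W N x * V N x)
       = expectation (\<lambda>x. S x * T x - (S x - W N x) * T x - S x * (T x - V N x) + (S x - W N x) * (T x - V N x))"
      by (intro Bochner_Integration.integral_cong) (auto simp: algebra_simps)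
    also have "\<dots> = expectation (\<lambda>x. S x * T x) - ?a N - ?b N + ?c N"
      using square_integrable_mult[OF W(2) V(2)] square_integrable_mult[OF dW V(2)]
        square_integrable_mult[OF W(2) dV] square_integrable_mult[OF dW dV] by simp
    finally show ?thesis by simp
  qed
  ultimately show ?thesis by simp
qed

definition white_noise :: "(int \<Rightarrow> 'a \<Rightarrow> real) \<Rightarrow> real \<Rightarrow> bool" where
  "white_noise e v \<longleftrightarrow> (\<forall>i. square_integrable (e i) \<and> expectation (e i) = 0) \<and>
     (\<forall>i j. expectation (\<lambda>x. e i x * e j x) = (if i = j then v else 0))"

lemma white_noise_expectation_mult_sums:
  assumes e: "white_noise e v" and fin: "finite A" "finite B"
  shows "expectation (\<lambda>x. (\<Sum>k\<in>A. a k * e (p k) x) * (\<Sum>l\<in>B. b l * e (q l) x))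
       = (\<Sum>k\<in>A. \<Sum>l\<in>B. a k * b l * (if p k = q l then v else 0))"
proof -
  have int: "integrable M (\<lambda>x. e i x * e j x)" for i j
    using e by (intro square_integrable_mult) (auto simp: white_noise_def)
  have "expectation (\<lambda>x. (\<Sum>k\<in>A. a k * e (p k) x) * (\<Sum>l\<in>B. b l * e (q l) x))
      = expectation (\<lambda>x. \<Sum>k\<in>A. \<Sum>l\<in>B. a k * b l * (e (p k) x * e (q l) x))"
    by (intro Bochner_Integration.integral_cong) (auto simp: sum_product mult_ac)
  also have "\<dots> = (\<Sum>k\<in>A. \<Sum>l\<in>B. a k * b l * expectation (\<lambda>x. e (p k) x * e (q l) x))"
    using int by (simp add: Bochner_Integration.integral_sum)
  also have "\<dots> = (\<Sum>k\<in>A. \<Sum>l\<in>B. a k * b l * (if p k = q l then v else 0))"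
    using e by (simp add: white_noise_def)
  finally show ?thesis .
qed

text \<open>
By orthogonality the increments of the partial sums have second moment \<open>v\<close> times a block of
\<open>\<Sum>k. (a k)\<^sup>2\<close>, so the tails of that series give the rate of convergence.
\<close>

lemma linear_process_L2:
  fixes S :: "'a \<Rightarrow> real" and e :: "int \<Rightarrow> 'a \<Rightarrow> real" and a :: "nat \<Rightarrow> real" and t :: int
  defines "W \<equiv> \<lambda>N x. \<Sum>k<N. a k * e (t - 1 - int k) x"
  assumes e: "white_noise e v" and a: "summable (\<lambda>k. (a k)\<^sup>2)"
    and S: "S \<in> borel_measurable M"
    and series: "AE x in M. (\<lambda>k. a k * e (t - 1 - int k) x) sums S x"
  shows "square_integrable S" "\<And>N. square_integrable (W N)"
    and "(\<lambda>N. expectation (\<lambda>x. (S x - W N x)\<^sup>2)) \<longlonglongrightarrow> 0" and "expectation S = 0"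
proof -
  show W: "square_integrable (W N)" for N
    unfolding W_def using e by (intro square_integrable_sum square_integrable_cmult) (auto simp: white_noise_def)
  have "v = expectation (\<lambda>x. (e 0 x)\<^sup>2)"
    using e by (simp add: white_noise_def power2_eq_square)
  then have v: "v \<ge> 0"
    by simp
  define \<epsilon> where "\<epsilon> = (\<lambda>N. v * (\<Sum>k. (a (k + N))\<^sup>2))"
  have Cauchy: "expectation (\<lambda>x. (W N' x - W N x)\<^sup>2) \<le> \<epsilon> N" if "N \<le> N'" for N N'
  proof -
    have diff: "W N' x - W N x = (\<Sum>k\<in>{N..<N'}. a k * e (t - 1 - int k) x)" for x
      unfolding W_def using that by (simp add: lessThan_atLeast0 sum_diff_nat_ivl)
    have "expectation (\<lambda>x. (W N' x - W N x)\<^sup>2)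
      = (\<Sum>k\<in>{N..<N'}. \<Sum>l\<in>{N..<N'}. a k * a l * (if t - 1 - int k = t - 1 - int l then v else 0))"
      unfolding diff power2_eq_square by (rule white_noise_expectation_mult_sums[OF e]) auto
    also have "\<dots> = (\<Sum>k\<in>{N..<N'}. v * (a k)\<^sup>2)"
      by (intro sum.cong) (auto simp: power2_eq_square if_distrib cong: if_cong)
    also have "\<dots> = v * (\<Sum>k<N' - N. (a (k + N))\<^sup>2)"
      using sum.shift_bounds_nat_ivl[of "\<lambda>k. (a k)\<^sup>2" 0 N "N' - N"] that
      by (simp add: lessThan_atLeast0 flip: sum_distrib_left)
    also have "\<dots> \<le> \<epsilon> N"
      unfolding \<epsilon>_def using v
      by (intro mult_left_mono sum_le_suminf summable_ignore_initial_segment a) auto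
    finally show ?thesis .
  qed
  have "(\<lambda>N. \<Sum>k. (a (k + N))\<^sup>2) \<longlonglongrightarrow> 0"
    by (rule suminf_exist_split2[OF a])
  then have eps: "\<epsilon> \<longlonglongrightarrow> 0"
    unfolding \<epsilon>_def using tendsto_mult_left[of _ 0 sequentially v] by simp
  have lim: "AE x in M. (\<lambda>N. W N x) \<longlonglongrightarrow> S x"
    using series by (simp add: sums_def W_def)
  note L2 = L2_limit_of_Cauchy[OF W S lim Cauchy]
  show S2: "square_integrable S"
    using L2(1) by blast
  have "expectation (\<lambda>x. (S x - W N x)\<^sup>2) \<le> \<epsilon> N" for N
    using L2(2) by blast
  then show to0: "(\<lambda>N. expectation (\<lambda>x. (S x - W N x)\<^sup>2)) \<longlonglongrightarrow> 0"
    by (intro tendsto_sandwich[OF _ _ tendsto_const eps]) auto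
  have "(\<lambda>N. expectation (\<lambda>x. W N x * 1)) \<longlonglongrightarrow> expectation (\<lambda>x. S x * 1)"
    by (rule expectation_mult_L2_tendsto[OF W S2 _ _ to0]) auto
  moreover have "expectation (W N) = 0" for N
    unfolding W_def using e
    by (subst Bochner_Integration.integral_sum) (auto simp: white_noise_def square_integrable_integrable)
  ultimately show "expectation S = 0"
    by (simp add: LIMSEQ_const_iff)
qed

lemma linear_process_autocovariance:
  fixes Y :: "int \<Rightarrow> 'a \<Rightarrow> real"
  assumes e: "white_noise e v" and a: "summable (\<lambda>k. (a k)\<^sup>2)"
    and Y: "\<And>t. Y t \<in> borel_measurable M"
    and series: "\<And>t. AE x in M. (\<lambda>k. a k * e (t - 1 - int k) x) sums (Y t x - \<omega>)"
  shows "autocovariance M Y t (int n) = v * autocorr (causal a) (int n)"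
proof -
  define S where "S = (\<lambda>t x. Y t x - \<omega>)"
  define W where "W = (\<lambda>t N x. \<Sum>k<N. a k * e (t - 1 - int k) x)"
  have L2: "square_integrable (S t)" "square_integrable (W t N)"
    "(\<lambda>N. expectation (\<lambda>x. (S t x - W t N x)\<^sup>2)) \<longlonglongrightarrow> 0" "expectation (S t) = 0" for t N
    using linear_process_L2[OF e a _ series[of t]] Y by (simp_all add: S_def W_def)
  have Y_eq: "Y t = (\<lambda>x. S t x + \<omega>)" for t
    by (simp add: S_def)
  have mean: "expectation (Y t) = \<omega>" for t
    using L2(4)[of t] square_integrable_integrable[OF L2(1)[of t]] by (simp add: Y_eq prob_space)
  \<comment> \<open>Cutting the later series \<open>n\<close> terms further on makes both partial sums end at the same innovation.\<close>
  have "(\<lambda>N. expectation (\<lambda>x. W (t + int n) (N + n) x * W t N x)) \<longlonglongrightarrow> expectation (\<lambda>x. S (t + int n) x * S t x)"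
    by (rule expectation_mult_L2_tendsto[OF L2(2,1,2,1) LIMSEQ_ignore_initial_segment[OF L2(3)] L2(3)])
  moreover have "expectation (\<lambda>x. W (t + int n) (N + n) x * W t N x) = v * (\<Sum>l<N. a l * a (l + n))" for N
  proof -
    have "expectation (\<lambda>x. W (t + int n) (N + n) x * W t N x)
      = (\<Sum>k<N + n. \<Sum>l<N. a k * a l * (if t + int n - 1 - int k = t - 1 - int l then v else 0))"
      unfolding W_def by (rule white_noise_expectation_mult_sums[OF e]) auto
    also have "\<dots> = (\<Sum>l<N. \<Sum>k<N + n. a k * a l * (if t + int n - 1 - int k = t - 1 - int l then v else 0))"
      by (rule sum.swap)
    also have "\<dots> = (\<Sum>l<N. \<Sum>k<N + n. if k = l + n then v * (a l * a (l + n)) else 0)"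
      by (intro sum.cong) auto
    also have "\<dots> = (\<Sum>l<N. v * (a l * a (l + n)))"
      by (intro sum.cong) auto
    finally show ?thesis
      by (simp add: sum_distrib_left)
  qed
  moreover have "(\<lambda>N. v * (\<Sum>l<N. a l * a (l + n))) \<longlonglongrightarrow> v * autocorr (causal a) (int n)"
    using sums_autocorr_causal[OF summable_causal_square[OF a], of n]
    by (intro tendsto_mult_left) (simp add: sums_def)
  ultimately have "expectation (\<lambda>x. S (t + int n) x * S t x) = v * autocorr (causal a) (int n)"
    using LIMSEQ_unique by simp
  then show ?thesis
    by (simp add: autocovariance_def covariance_def mean S_def)
qed

end

section \<open>The logarithmic volatility of an SFIEGARCH process\<close>

context sfiegarch
begin

lemma Z_rv [measurable]: "Z t \<in> borel_measurable M"
  using Z_integrable[of t] by auto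

lemma Z_same_expectation:
  fixes h :: "real \<Rightarrow> real"
  assumes h: "h \<in> borel_measurable borel"
  shows "expectation (\<lambda>x. h (Z t x)) = expectation (\<lambda>x. h (Z 0 x))"
  using Z_ident[of t] integral_distr[OF Z_rv h, of t] integral_distr[OF Z_rv h, of 0] by simp

lemma Z_square_integrable: "square_integrable (Z t)"
proof -
  have "expectation (\<lambda>x. (Z t x)\<^sup>2) = 1"
    using Z_var[of t] Z_mean[of t] by simp
  then have "integrable M (\<lambda>x. (Z t x)\<^sup>2)"
    using not_integrable_integral_eq by fastforce
  then show ?thesis
    by (simp add: square_integrable_def)
qed

definition news_impact :: "real \<Rightarrow> real" where
  "news_impact z = \<theta> * z + \<gamma> * (\<bar>z\<bar> - expectation (\<lambda>x. \<bar>Z 0 x\<bar>))"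

lemma news_impact_measurable [measurable]: "news_impact \<in> borel_measurable borel"
  unfolding news_impact_def by measurable

lemma innov_eq: "innov M \<theta> \<gamma> (Z t) = (\<lambda>x. news_impact (Z t x))"
  using Z_same_expectation[of abs t] by (auto simp: innov_def news_impact_def)

lemma news_impact_square_integrable: "square_integrable (\<lambda>x. news_impact (Z t x))"
proof -
  have "square_integrable (\<lambda>x. \<bar>Z t x\<bar>)"
    using Z_square_integrable[of t] by (simp add: square_integrable_def)
  then show ?thesis
    unfolding news_impact_def
    by (intro square_integrable_add square_integrable_cmult square_integrable_diff Z_square_integrable
        square_integrable_const)
qed

lemma news_impact_mean: "expectation (\<lambda>x. news_impact (Z t x)) = 0"
proof -
  have "expectation (\<lambda>x. \<bar>Z t x\<bar>) = expectation (\<lambda>x. \<bar>Z 0 x\<bar>)"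
    by (rule Z_same_expectation) simp
  then show ?thesis
    using Z_integrable[of t] Z_mean[of t] by (simp add: news_impact_def prob_space)
qed

lemma innov_white_noise: "white_noise (\<lambda>t. innov M \<theta> \<gamma> (Z t)) (variance (innov M \<theta> \<gamma> (Z 0)))"
  unfolding white_noise_def innov_eq
proof (intro conjI allI)
  fix i j
  show "expectation (\<lambda>x. news_impact (Z i x) * news_impact (Z j x))
      = (if i = j then variance (\<lambda>x. news_impact (Z 0 x)) else 0)"
  proof (cases "i = j")
    case True
    have "expectation (\<lambda>x. (news_impact (Z i x))\<^sup>2) = expectation (\<lambda>x. (news_impact (Z 0 x))\<^sup>2)"
      by (rule Z_same_expectation[of "\<lambda>z. (news_impact z)\<^sup>2"]) simp
    then show ?thesis
      using True news_impact_mean[of 0] by (simp add: power2_eq_square)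
  next
    case False
    have "indep_vars (\<lambda>_. borel) (\<lambda>i x. news_impact (Z i x)) UNIV"
      by (rule indep_vars_compose2[OF Z_indep]) simp
    then have "indep_vars (\<lambda>_. borel) (\<lambda>i x. news_impact (Z i x)) {i, j}"
      by (rule indep_vars_subset) simp
    then have "expectation (\<lambda>x. \<Prod>k\<in>{i, j}. news_impact (Z k x)) = (\<Prod>k\<in>{i, j}. expectation (\<lambda>x. news_impact (Z k x)))"
      by (intro indep_vars_lebesgue_integral square_integrable_integrable news_impact_square_integrable) auto
    then show ?thesis
      using False by (simp add: news_impact_mean)
  qed
qed (use news_impact_square_integrable news_impact_mean in auto)

lemma log_volatility_autocovariance:
  assumes "summable (\<lambda>k. (lam k)\<^sup>2)"
  shows "autocovariance M (\<lambda>u x. ln ((\<sigma> u x)\<^sup>2)) t (int n)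
       = variance (innov M \<theta> \<gamma> (Z 0)) * autocorr (causal lam) (int n)"
proof (rule linear_process_autocovariance[OF innov_white_noise assms _ log_vol])
  show "(\<lambda>x. ln ((\<sigma> t x)\<^sup>2)) \<in> borel_measurable M" for t
    using sigma_rv[of t] by measurable
qed

end

theorem corollary2p3:
  fixes M :: "'a measure"
    and p q s :: nat
    and d \<omega> \<theta> \<gamma> :: real
    and a b lam f :: "nat \<Rightarrow> real"
    and Z \<sigma> X :: "int \<Rightarrow> 'a \<Rightarrow> real"
  assumes "sfiegarch M p q s d \<omega> \<theta> \<gamma> a b lam Z \<sigma> X"
    and "unit_disc_expansion (\<lambda>z. poly (lag_poly p a) z / poly (lag_poly q b) z) f"
    and "d < 1 / 2"
    and "\<not> (\<gamma> = 0 \<and> \<theta> = 0)"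
  shows "\<exists>G :: int \<Rightarrow> real.
    (\<forall>t. \<forall>r \<in> {0..<s}. \<forall>\<nu>>0.
       (\<lambda>h::nat. autocovariance M (\<lambda>u x. ln ((\<sigma> u x)\<^sup>2)) t (int (s * h + r))
          - gamma_V s d (prob_space.variance M (innov M \<theta> \<gamma> (Z 0))) (int (s * h))
            * G (int (s * h + r)))
       \<in> o(\<lambda>h. real h powr (- \<nu>)))
    \<and> (\<lambda>h::nat. \<Sum>r = 0..<s. G (int (s * h + r)))
        \<longlonglongrightarrow> (\<Sum>\<^sub>\<infinity>k\<in>(UNIV :: int set). gamma_A f k)"
proof -
  interpret sfiegarch M p q s d \<omega> \<theta> \<gamma> a b lam Z \<sigma> X
    by (rule assms(1))
  note d = assms(3)
  define v where "v = variance (innov M \<theta> \<gamma> (Z 0))"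
  define c where "c = (\<lambda>h. autocorr (causal (frac_coeff d)) (int h))"
  define u where "u = causal (upsample s (frac_coeff d))"
  define L where "L = (\<Sum>\<^sub>\<infinity>k\<in>(UNIV :: int set). gamma_A f k)"
  obtain y where y: "y > 1" and f: "summable (\<lambda>k. \<bar>f k\<bar> * y ^ k)"
    using rational_expansion_decay[OF assms(2) b_nonzero] by blast
  note w = weighted_causal_summable[OF f less_imp_le[OF y]]
  have c_square: "square_summable (causal (frac_coeff d))"
    by (intro summable_causal_square frac_coeff_square_summable d)
  have u: "square_summable u"
    unfolding u_def
    by (intro summable_causal_square upsample_square_summable frac_coeff_square_summable s_pos d)
  have corr: "autocorr u n = (if int s dvd n then c (nat \<bar>n div int s\<bar>) else 0)" for n
    using autocorr_minus[OF c_square, of "n div int s"]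
    by (simp add: u_def c_def autocorr_upsample[OF s_pos c_square] abs_if)
  have "unit_disc_expansion
      (\<lambda>z. poly (lag_poly p a) z / poly (lag_poly q b) z * (1 - z ^ s) powr (- complex_of_real d))
      (\<lambda>k. \<Sum>i\<le>k. f i * upsample s (frac_coeff d) (k - i))"
    by (intro unit_disc_expansion_mult assms(2) frac_coeff_expansion s_pos)
  then have "lam = (\<lambda>k. \<Sum>i\<le>k. f i * upsample s (frac_coeff d) (k - i))"
    by (rule unit_disc_expansion_unique[OF expansion])
  then have lam: "causal lam = convolve (causal f) u"
    by (simp add: u_def convolve_causal)
  have f_square: "square_summable (causal f)"
    by (rule abs_summable_imp_square_summable[OF w(2)])
  have lam_square: "summable (\<lambda>k. (lam k)\<^sup>2)"
  proof -
    have "((\<lambda>k. causal lam k * causal lam (k + 0)) has_sum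
        (\<Sum>\<^sub>\<infinity>(i, j). causal f i * causal f j * autocorr u (0 + i - j))) UNIV"
      unfolding lam by (rule has_sum_autocorr_convolve[OF w(2) u])
    then have "((\<lambda>k. (causal lam (int k))\<^sup>2) has_sum
        (\<Sum>\<^sub>\<infinity>(i, j). causal f i * causal f j * autocorr u (0 + i - j))) UNIV"
      by (subst (asm) causal_reindex) (auto simp: causal_def power2_eq_square)
    then show ?thesis
      by (auto simp: causal_def dest: has_sum_imp_sums sums_summable)
  qed
  have cov: "autocovariance M (\<lambda>u x. ln ((\<sigma> u x)\<^sup>2)) t (int n) = v * autocorr (causal lam) (int n)" for t n
    unfolding v_def by (rule log_volatility_autocovariance[OF lam_square])
  have L: "L = (infsum (causal f) UNIV)\<^sup>2"
    unfolding L_def gamma_A_eq_autocorr[OF f_square]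
    by (rule infsumI[OF has_sum_autocorr_all[OF w(2)]])
  have gV: "gamma_V s d v (int (s * h)) = v * c h" for h
    by (simp only: c_def gamma_V_eq_autocorr[OF s_pos d])
  have "\<exists>G :: int \<Rightarrow> real.
    (\<forall>r \<in> {0..<s}. \<forall>\<nu>>0. (\<lambda>h. v * autocorr (causal lam) (int (s * h + r)) - v * c h * G (int (s * h + r)))
       \<in> o(\<lambda>h. real h powr (- \<nu>)))
    \<and> (\<lambda>h. \<Sum>r = 0..<s. G (int (s * h + r))) \<longlonglongrightarrow> L"
  proof (cases "d \<in> \<int>")
    case False
    have c_nz: "c h \<noteq> 0" for h
      unfolding c_def by (rule frac_autocorr_nonzero[OF d False])
    \<comment> \<open>\<open>n div s\<close> recovers \<open>h\<close> from \<open>n = s * h + r\<close> with \<open>r < s\<close>.\<close>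
    define G where "G = (\<lambda>n :: int. autocorr (causal lam) n / c (nat (n div int s)))"
    have G: "G (int (s * h + r)) = autocorr (causal lam) (int (s * h + r)) / c h" if "r < s" for h r
      using that by (simp add: G_def flip: zdiv_int)
    have "(\<lambda>h. (\<Sum>r = 0..<s. autocorr (causal lam) (int (s * h + r))) / c h) \<longlonglongrightarrow> L"
      unfolding lam L
      by (rule period_sum_autocorr_asymptotic[OF s_pos y f u corr c_nz])
        (use frac_autocorr_ratio[OF d False] in \<open>simp add: c_def\<close>)
    then have "(\<lambda>h. \<Sum>r = 0..<s. G (int (s * h + r))) \<longlonglongrightarrow> L"
      by (simp add: G sum_divide_distrib del: of_nat_add of_nat_mult)
    moreover have "(\<lambda>h. v * autocorr (causal lam) (int (s * h + r)) - v * c h * G (int (s * h + r))) = (\<lambda>_. 0)"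
      if "r < s" for r
      using c_nz by (simp add: G[OF that] fun_eq_iff del: of_nat_add of_nat_mult)
    ultimately show ?thesis
      by (intro exI[of _ G]) (simp del: of_nat_add of_nat_mult)
  next
    case True
    \<comment> \<open>\<open>D\<close> is the degree of \<open>(1 - z ^ s) ^ (- d)\<close>: its coefficients have no autocorrelation beyond lag \<open>D\<close>.\<close>
    define D where "D = s * nat \<lceil>- d\<rceil>"
    have c_zero: "c h = 0" if "real h > - d" for h
      unfolding c_def by (rule frac_autocorr_integer[OF d True that])
    have "autocorr u n = 0" if "n > int D" for n
    proof (cases "int s dvd n")
      case dvd: True
      then obtain l where l: "n = int s * l" by blast
      then have "int (nat \<lceil>- d\<rceil>) < l"
        using that s_pos by (simp add: D_def)
      then have "real (nat \<bar>l\<bar>) > - d"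
        by linarith
      then show ?thesis
        using s_pos by (simp add: corr l c_zero)
    qed (simp add: corr)
    then obtain C where C: "\<bar>autocorr (causal lam) (int n)\<bar> \<le> C / y ^ n" for n
      unfolding lam using autocorr_convolve_exponential_decay[OF y f u] by blast
    have C0: "C \<ge> 0"
      using C[of 0] by simp
    have small: "(\<lambda>h. v * autocorr (causal lam) (int (s * h + r)) - v * c h * (L / real s))
       \<in> o(\<lambda>h. real h powr (- \<nu>))" if "\<nu> > 0" for r \<nu>
    proof (rule landau_o.big_small_trans)
      have "\<forall>\<^sub>F h in sequentially. norm (v * autocorr (causal lam) (int (s * h + r)) - v * c h * (L / real s))
          \<le> \<bar>v\<bar> * C * norm ((1 / y) ^ h)"
        using eventually_gt_at_top[of "nat \<lceil>- d\<rceil>"]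
      proof eventually_elim
        case (elim h)
        then have "c h = 0"
          by (intro c_zero) linarith
        have "h \<le> s * h + r"
          using s_pos by (simp add: trans_le_add1)
        then have "y ^ h \<le> y ^ (s * h + r)"
          using y by (intro power_increasing) auto
        then have "C / y ^ (s * h + r) \<le> C / y ^ h"
          using y C0 by (intro divide_left_mono) auto
        then have "\<bar>autocorr (causal lam) (int (s * h + r))\<bar> \<le> C / y ^ h"
          using C[of "s * h + r"] by linarith
        then have "\<bar>v\<bar> * \<bar>autocorr (causal lam) (int (s * h + r))\<bar> \<le> \<bar>v\<bar> * (C / y ^ h)"
          by (intro mult_left_mono) auto
        then show ?case
          using \<open>c h = 0\<close> y by (simp add: abs_mult power_one_over)
      qed
      then show "(\<lambda>h. v * autocorr (causal lam) (int (s * h + r)) - v * c h * (L / real s)) \<in> O(\<lambda>h. (1 / y) ^ h)"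
        by (rule bigoI)
      show "(\<lambda>h. (1 / y) ^ h) \<in> o(\<lambda>h. real h powr (- \<nu>))"
        using y by real_asymp
    qed
    have "(\<Sum>r = 0..<s. L / real s) = L"
      using s_pos by simp
    with small show ?thesis
      by (intro exI[of _ "\<lambda>_. L / real s"]) (simp del: of_nat_add of_nat_mult)
  qed
  then show ?thesis
    unfolding L_def[symmetric] v_def[symmetric] cov gV by blast
qed

end
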